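(* Let $\nu\ge2$ be an integer, let $\vec\omega\in\mathbb{R}^\nu$ be non-resonant, and let $a\in(0,1)\cup(1,\infty)$. Set $$\sigma_a=\begin{cases}0&(a\ge2),\\ \frac{2-a}{8}&(a\in(0,1)\cup(1,2)).\end{cases}$$ Then there is a constant $K$ depending only on $\nu,\vec\omega,a$ such that for every $f\in\mathcal{T}_{\vec\omega}(\mathbb{R})$, $$\|e^{2\pi it|D_x|^a}f\|_{L^4_t\mathcal{L}^4_x([0,1]\times\mathbb{R})}\le K\,\|f\|_{\mathcal{H}^{\frac{\nu-1}{4}+\sigma_a}_{\vec\omega}(\mathbb{R})}$$ (and hence the estimate extends by density to all $f\in\mathcal{H}^{\frac{\nu-1}{4}+\sigma_a}_{\vec\omega}(\mathbb{R})$).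
   Context: A vector $\vec\omega\in\mathbb{R}^\nu$ is non-resonant if its components are linearly independent over $\mathbb{Q}$. $\mathcal{T}_{\vec\omega}(\mathbb{R})$ is the set of trigonometric polynomials $f(x)=\sum_{k\in\mathbb{Z}^\nu}a_ke^{2\pi i(k\cdot\vec\omega)x}$, $x\in\mathbb{R}$, with only finitely many nonzero $a_k\in\mathbb{C}$; write $\widehat f(k\cdot\vec\omega)=a_k$. For $1\le p<\infty$, $\|f\|_{\mathcal{L}^p(\mathbb{R})}^p:=\limsup_{L\to\infty}\frac1{2L}\int_{-L}^{L}|f(x)|^p\,dx$, and $\|u\|_{L^p_t\mathcal{L}^p_x([0,1]\times\mathbb{R})}:=\bigl(\int_0^1\|u(t,\cdot)\|_{\mathcal{L}^p(\mathbb{R})}^p\,dt\bigr)^{1/p}$. For $s\in\mathbb{R}$, $\|f\|_{\mathcal{H}^s_{\vec\omega}(\mathbb{R})}^2:=\sum_{k\in\mathbb{Z}^\nu}(1+|k|^2)^s|\widehat f(k\cdot\vec\omega)|^2$, and $\mathcal{H}^s_{\vec\omega}(\mathbb{R})$ is the completion of $\mathcal{T}_{\vec\omega}(\mathbb{R})$ under this norm. The fractional Schrödinger propagator is $e^{2\pi it|D_x|^a}f(x):=\sum_{k\in\mathbb{Z}^\nu}e^{2\pi i[(\vec\omega\cdot k)x+|\vec\omega\cdot k|^at]}\widehat f(\vec\omega\cdot k)$ for $f\in\mathcal{T}_{\vec\omega}(\mathbb{R})$. *)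

theory Defs
  imports "HOL-Analysis.Analysis"
begin

definition rvec :: "int ^ 'n::finite \<Rightarrow> real ^ 'n" where
  "rvec k = (\<chi> i. real_of_int (k $ i))"

definition nonresonant :: "real ^ 'n::finite \<Rightarrow> bool" where
  "nonresonant \<omega> \<longleftrightarrow>
     (\<forall>q :: 'n \<Rightarrow> rat. (\<Sum>i\<in>UNIV. real_of_rat (q i) * \<omega> $ i) = 0 \<longrightarrow> (\<forall>i. q i = 0))"

definition trig_sum :: "real ^ 'n::finite \<Rightarrow> (int ^ 'n \<Rightarrow> complex) \<Rightarrow> real \<Rightarrow> complex" where
  "trig_sum \<omega> c x = (\<Sum>k | c k \<noteq> 0. c k * cis (2 * pi * (rvec k \<bullet> \<omega>) * x))"

definition trig_polys :: "real ^ 'n::finite \<Rightarrow> (real \<Rightarrow> complex) set" where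
  "trig_polys \<omega> = {trig_sum \<omega> c | c. finite {k. c k \<noteq> 0}}"

text \<open>
  The coefficient of \<open>f\<close> at the frequency \<open>rvec k \<bullet> \<omega>\<close>. For nonresonant \<open>\<omega>\<close> the
  coefficient family is unique; see \<open>fourier_coeff_trig_sum\<close> below.
\<close>
definition fourier_coeff :: "real ^ 'n::finite \<Rightarrow> (real \<Rightarrow> complex) \<Rightarrow> int ^ 'n \<Rightarrow> complex" where
  "fourier_coeff \<omega> f = (THE c. finite {k. c k \<noteq> 0} \<and> f = trig_sum \<omega> c)"

lemma cis_independent:
  fixes S :: "real set"
  assumes "finite S" and "\<And>x. (\<Sum>l\<in>S. c l * cis (l * x)) = 0"
  shows "\<forall>l\<in>S. c l = 0"
  using assms
proof (induction S arbitrary: c rule: finite_induct)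
  case empty
  then show ?case by simp
next
  case (insert m S)
  have *: "c l = 0" if "l \<in> S" for l
  proof -
    define h where "h = pi / (l - m)"
    have "l \<noteq> m" using insert.hyps that by auto
    then have lh: "l * h = m * h + pi" by (simp add: h_def field_simps)
    have cis_shift: "cis (l * (x + h)) = cis (l * x) * cis (l * h)" for l x
      by (simp add: cis_mult distrib_left)
    have "(\<Sum>l\<in>S. (c l * (cis (l * h) - cis (m * h))) * cis (l * x)) = 0" for x
    proof -
      have "(\<Sum>l\<in>S. (c l * (cis (l * h) - cis (m * h))) * cis (l * x))
          = (\<Sum>l\<in>insert m S. (c l * (cis (l * h) - cis (m * h))) * cis (l * x))"
        using insert.hyps by simp
      also have "\<dots> = (\<Sum>l\<in>insert m S. c l * cis (l * (x + h)) - cis (m * h) * (c l * cis (l * x)))"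
        unfolding cis_shift by (rule sum.cong) (simp_all only: ring_distribs mult_ac)
      also have "\<dots> = (\<Sum>l\<in>insert m S. c l * cis (l * (x + h)))
          - cis (m * h) * (\<Sum>l\<in>insert m S. c l * cis (l * x))"
        by (simp only: sum_subtractf sum_distrib_left)
      finally show ?thesis
        by (simp only: insert.prems) simp
    qed
    then have "\<forall>l\<in>S. c l * (cis (l * h) - cis (m * h)) = 0"
      by (rule insert.IH)
    then have "c l * (cis (l * h) - cis (m * h)) = 0" using that by blast
    moreover have "cis (l * h) - cis (m * h) = - 2 * cis (m * h)"
      by (simp add: lh cis.ctr complex_eq_iff)
    ultimately show ?thesis by simp
  qed
  have "c m * cis (m * 0) = 0"
    using insert.prems[of 0] insert.hyps * by simp
  then show ?case using * by simp
qed

lemma nonresonant_inj: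
  assumes "nonresonant \<omega>"
  shows "inj (\<lambda>k. 2 * pi * (rvec k \<bullet> \<omega>))"
proof (rule injI)
  fix k l :: "int ^ 'a"
  assume "2 * pi * (rvec k \<bullet> \<omega>) = 2 * pi * (rvec l \<bullet> \<omega>)"
  then have "rvec k \<bullet> \<omega> = rvec l \<bullet> \<omega>" by simp
  then have "(\<Sum>i\<in>UNIV. real_of_rat (of_int (k $ i - l $ i)) * \<omega> $ i) = 0"
    by (simp add: rvec_def inner_vec_def of_rat_diff algebra_simps sum_subtractf)
  then have "\<forall>i. (of_int (k $ i - l $ i) :: rat) = 0"
    by (rule assms[unfolded nonresonant_def, THEN spec, THEN mp])
  then show "k = l" by (simp add: vec_eq_iff)
qed

lemma trig_sum_superset:
  assumes "finite S" "{k. c k \<noteq> 0} \<subseteq> S"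
  shows "trig_sum \<omega> c x = (\<Sum>k\<in>S. c k * cis (2 * pi * (rvec k \<bullet> \<omega>) * x))"
  unfolding trig_sum_def using assms by (intro sum.mono_neutral_left) auto

lemma fourier_coeff_trig_sum:
  assumes \<omega>: "nonresonant \<omega>" and c: "finite {k. c k \<noteq> 0}"
  shows "fourier_coeff \<omega> (trig_sum \<omega> c) = c"
  unfolding fourier_coeff_def
proof (rule the_equality)
  show "finite {k. c k \<noteq> 0} \<and> trig_sum \<omega> c = trig_sum \<omega> c" using c by simp
next
  fix d
  assume d: "finite {k. d k \<noteq> 0} \<and> trig_sum \<omega> c = trig_sum \<omega> d"
  define S where "S = {k. c k \<noteq> 0} \<union> {k. d k \<noteq> 0}"
  define p where "p = (\<lambda>k. 2 * pi * (rvec k \<bullet> \<omega>))"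
  have S: "finite S" using c d by (simp add: S_def)
  have cS: "{k. c k \<noteq> 0} \<subseteq> S" and dS: "{k. d k \<noteq> 0} \<subseteq> S" by (auto simp: S_def)
  have inj: "inj p" unfolding p_def by (rule nonresonant_inj[OF \<omega>])
  have "(\<Sum>l\<in>p ` S. (c (inv p l) - d (inv p l)) * cis (l * x)) = 0" for x
  proof -
    have "(\<Sum>l\<in>p ` S. (c (inv p l) - d (inv p l)) * cis (l * x))
        = (\<Sum>k\<in>S. (c k - d k) * cis (p k * x))"
      by (subst sum.reindex) (simp_all add: inj inj_on_subset[OF inj])
    also have "\<dots> = trig_sum \<omega> c x - trig_sum \<omega> d x"
      by (simp add: trig_sum_superset[OF S cS] trig_sum_superset[OF S dS] p_def
          left_diff_distrib sum_subtractf)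
    also have "\<dots> = 0" using d by simp
    finally show ?thesis .
  qed
  with S have "\<forall>l\<in>p ` S. c (inv p l) - d (inv p l) = 0"
    by (intro cis_independent) auto
  then have "\<forall>k\<in>S. c k = d k" using inj by simp
  moreover have "c k = d k" if "k \<notin> S" for k using that by (simp add: S_def)
  ultimately show "d = c" by (intro ext) metis
qed

text \<open>
  All norms take values in \<^typ>\<open>ennreal\<close>, so that an estimate also asserts finiteness.
\<close>

definition ennreal_root :: "real \<Rightarrow> ennreal \<Rightarrow> ennreal" where
  "ennreal_root p y = (if y = \<infinity> then \<infinity> else ennreal (enn2real y powr (1 / p)))"

definition mean_norm_pow :: "real \<Rightarrow> (real \<Rightarrow> complex) \<Rightarrow> ennreal" where
  "mean_norm_pow p f =
     Limsup at_top (\<lambda>L. ennreal (1 / (2 * L)) * (\<integral>\<^sup>+x\<in>{-L..L}. ennreal (norm (f x) powr p) \<partial>lborel))"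

text \<open>
  \<open>mean_norm_pow p (u t)\<close> is already the \<open>p\<close>-th power of the norm of \<open>u t\<close>.
\<close>
definition mixed_norm :: "real \<Rightarrow> (real \<Rightarrow> real \<Rightarrow> complex) \<Rightarrow> ennreal" where
  "mixed_norm p u = ennreal_root p (\<integral>\<^sup>+t\<in>{0..1}. mean_norm_pow p (u t) \<partial>lborel)"

definition sobolev_norm :: "real ^ 'n::finite \<Rightarrow> real \<Rightarrow> (real \<Rightarrow> complex) \<Rightarrow> ennreal" where
  "sobolev_norm \<omega> s f =
     ennreal (sqrt (\<Sum>k | fourier_coeff \<omega> f k \<noteq> 0.
       (1 + (norm (rvec k))\<^sup>2) powr s * (norm (fourier_coeff \<omega> f k))\<^sup>2))"

definition propagator ::
    "real ^ 'n::finite \<Rightarrow> real \<Rightarrow> (real \<Rightarrow> complex) \<Rightarrow> real \<Rightarrow> real \<Rightarrow> complex" where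
  "propagator \<omega> a f t x =
     (\<Sum>k | fourier_coeff \<omega> f k \<noteq> 0.
       fourier_coeff \<omega> f k * cis (2 * pi * ((rvec k \<bullet> \<omega>) * x + \<bar>rvec k \<bullet> \<omega>\<bar> powr a * t)))"

definition sigma :: "real \<Rightarrow> real" where
  "sigma a = (if a \<ge> 2 then 0 else (2 - a) / 8)"

definition cauchy_seqs :: "'v::minus set \<Rightarrow> ('v \<Rightarrow> ennreal) \<Rightarrow> (nat \<Rightarrow> 'v) set" where
  "cauchy_seqs V N =
     {X. (\<forall>n. X n \<in> V) \<and> (\<forall>e>0. \<exists>M. \<forall>m\<ge>M. \<forall>n\<ge>M. N (X m - X n) < e)}"

definition null_rel :: "'v::minus set \<Rightarrow> ('v \<Rightarrow> ennreal) \<Rightarrow> ((nat \<Rightarrow> 'v) \<times> (nat \<Rightarrow> 'v)) set" where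
  "null_rel V N =
     {(X, Y). X \<in> cauchy_seqs V N \<and> Y \<in> cauchy_seqs V N \<and> (\<lambda>n. N (X n - Y n)) \<longlonglongrightarrow> 0}"

definition completion :: "'v::minus set \<Rightarrow> ('v \<Rightarrow> ennreal) \<Rightarrow> (nat \<Rightarrow> 'v) set set" where
  "completion V N = cauchy_seqs V N // null_rel V N"

text \<open>
  Meaningful because the norms of all representatives of a class converge to the same limit.
\<close>
definition completion_norm :: "('v \<Rightarrow> ennreal) \<Rightarrow> (nat \<Rightarrow> 'v) set \<Rightarrow> ennreal" where
  "completion_norm N \<xi> = the_elem ((\<lambda>X. lim (\<lambda>n. N (X n))) ` \<xi>)"

text \<open>
  The continuous extension of \<open>T\<close> to classes of Cauchy sequences: the class of the image sequence.
  This is a single class of \<open>completion W N\<close> when \<open>T\<close> is linear and bounded.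
\<close>
definition completion_map ::
    "('v \<Rightarrow> 'w::minus) \<Rightarrow> 'w set \<Rightarrow> ('w \<Rightarrow> ennreal) \<Rightarrow> (nat \<Rightarrow> 'v) set \<Rightarrow> (nat \<Rightarrow> 'w) set" where
  "completion_map T W N \<xi> = (\<Union>X\<in>\<xi>. null_rel W N `` {\<lambda>n. T (X n)})"

abbreviation sobolev_space :: "real ^ 'n::finite \<Rightarrow> real \<Rightarrow> (nat \<Rightarrow> real \<Rightarrow> complex) set set" where
  "sobolev_space \<omega> s \<equiv> completion (trig_polys \<omega>) (sobolev_norm \<omega> s)"

end

theory Submission
  imports Defs
begin

text \<open>
  For nonresonant \<open>\<omega>\<close> the mean of \<open>|u(t, x)|\<^sup>4\<close> over \<open>x\<close> is, by Parseval applied to \<open>u\<^sup>2\<close>, the sum over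
  \<open>m\<close> of \<open>|\<Sum>\<^bsub>k + l = m\<^esub> c\<^sub>k c\<^sub>l e\<^bsup>2 \<pi> i (\<phi>(k) + \<phi>(l)) t\<^esup>|\<^sup>2\<close>, where \<open>\<phi>(k) = |k \<bullet> \<omega>|\<^sup>a\<close>. A Fejer window in \<open>t\<close>
  reduces its integral over \<open>[0, 1]\<close> to the sums over the pairs for which \<open>k + l\<close> and
  \<open>\<lfloor>\<phi>(k) + \<phi>(l)\<rfloor>\<close> are prescribed. Off the points where \<open>y\<close> or \<open>M - y\<close> changes sign, the function
  \<open>y \<mapsto> |y|\<^sup>a + |M - y|\<^sup>a\<close> is uniformly convex or concave, so it takes values in a unit interval only on
  boundedly many intervals of length \<open>O(R\<^bsup>4 \<sigma>\<^esup>)\<close> within \<open>|y| \<le> R\<close>, and these contain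
  \<open>O(R\<^bsup>\<nu> - 1 + 4 \<sigma>\<^esup>) = O(R\<^bsup>4 s\<^esup>)\<close> frequencies of lattice points of norm at most \<open>R\<close>.
  Hence a pair of dyadic pieces at scales \<open>R\<^sub>1 \<le> R\<^sub>2\<close> contributes at most \<open>O(R\<^sub>1\<^bsup>2 s\<^esup>)\<close> times the product
  of the \<open>L\<^sup>2\<close> norms to the \<open>L\<^sup>2\<close> norm of \<open>u\<^sup>2\<close>. Relative to the Sobolev norms this is a gain of
  \<open>(R\<^sub>1 / R\<^sub>2)\<^sup>s\<close>, and since \<open>s > 0\<close> the pairs of scales can be summed without loss.
\<close>

section \<open>Parseval and a large sieve inequality\<close>

lemma has_integral_cis:
  assumes "l \<noteq> 0" "a \<le> b"
  shows "((\<lambda>x. cis (l * x)) has_integral (cis (l * b) - cis (l * a)) / (\<i> * of_real l)) {a..b}"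
proof -
  have "((\<lambda>x. cis (l * x)) has_integral cis (l * b) / (\<i> * of_real l) - cis (l * a) / (\<i> * of_real l)) {a..b}"
  proof (rule fundamental_theorem_of_calculus[OF \<open>a \<le> b\<close>])
    fix x
    show "((\<lambda>x. cis (l * x) / (\<i> * of_real l)) has_vector_derivative cis (l * x)) (at x within {a..b})"
      unfolding has_vector_derivative_def
      by (rule derivative_eq_intros refl)+ (use \<open>l \<noteq> 0\<close> in \<open>auto simp: field_simps scaleR_conv_of_real\<close>)
  qed
  then show ?thesis by (simp add: diff_divide_distrib)
qed

text \<open>For nonzero \<open>l\<close> the primitive of \<open>cis (l * x)\<close> is bounded, so
  the mean over \<open>{-L..L}\<close> is of order \<open>1 / L\<close>. This is orthonormality of
  the characters under the mean.\<close>

lemma mean_cis_tendsto: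
  "((\<lambda>L. of_real (1 / (2 * L)) * integral {-L..L} (\<lambda>x. cis (l * x))) \<longlongrightarrow> of_bool (l = 0)) at_top"
proof (cases "l = 0")
  case True
  have "\<forall>\<^sub>F L in at_top. of_real (1 / (2 * L)) * integral {-L..L} (\<lambda>x. cis (l * x)) = (1::complex)"
    using eventually_gt_at_top[of 0] by eventually_elim (simp add: True scaleR_conv_of_real)
  then show ?thesis by (simp add: True tendsto_eventually)
next
  case False
  have "((\<lambda>L. of_real (1 / (2 * L)) * integral {-L..L} (\<lambda>x. cis (l * x))) \<longlongrightarrow> 0) at_top"
  proof (rule Lim_null_comparison)
    show "\<forall>\<^sub>F L in at_top. norm (of_real (1 / (2 * L)) * integral {-L..L} (\<lambda>x. cis (l * x))) \<le> 1 / (\<bar>l\<bar> * L)"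
      using eventually_gt_at_top[of 0]
    proof eventually_elim
      case (elim L)
      have "norm (cis (l * L) - cis (l * -L)) \<le> 2"
        using norm_triangle_ineq4[of "cis (l * L)" "cis (l * -L)"] by simp
      with elim False show ?case
        by (subst integral_unique[OF has_integral_cis])
          (auto simp: norm_mult norm_divide divide_simps)
    qed
    show "((\<lambda>L. 1 / (\<bar>l\<bar> * L)) \<longlongrightarrow> 0) at_top"
      using False by (intro tendsto_divide_0[OF tendsto_const] filterlim_at_top_imp_at_infinity
          filterlim_tendsto_pos_mult_at_top[OF tendsto_const _ filterlim_ident]) auto
  qed
  then show ?thesis using False by simp
qed

lemma norm_sum_square_expand:
  fixes z :: "'i \<Rightarrow> complex"
  shows "of_real ((norm (\<Sum>i\<in>S. z i))\<^sup>2) = (\<Sum>i\<in>S. \<Sum>j\<in>S. z i * cnj (z j))"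
  by (simp only: complex_norm_square cnj_sum sum_product)

text \<open>Expanding the square gives a double sum of characters of frequency
  \<open>\<mu> m - \<mu> n\<close>, and the mean keeps only the vanishing differences. Injectivity
  of \<open>\<mu>\<close> makes these the diagonal terms.\<close>

lemma mean_square_trig_tendsto:
  assumes "finite S" "inj_on \<mu> S"
  shows "((\<lambda>L. 1 / (2 * L) * integral {-L..L} (\<lambda>x. (norm (\<Sum>m\<in>S. c m * cis (\<mu> m * x)))\<^sup>2))
    \<longlongrightarrow> (\<Sum>m\<in>S. (norm (c m))\<^sup>2)) at_top"
proof -
  let ?f = "\<lambda>x. (norm (\<Sum>m\<in>S. c m * cis (\<mu> m * x)))\<^sup>2"
  have expand: "of_real (?f x) = (\<Sum>m\<in>S. \<Sum>n\<in>S. c m * cnj (c n) * cis ((\<mu> m - \<mu> n) * x))" for x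
    unfolding norm_sum_square_expand
  proof (intro sum.cong refl)
    fix m n
    have "cis ((\<mu> m - \<mu> n) * x) = cis (\<mu> m * x) * cnj (cis (\<mu> n * x))"
      by (simp add: cis_cnj cis_mult left_diff_distrib)
    then show "c m * cis (\<mu> m * x) * cnj (c n * cis (\<mu> n * x)) = c m * cnj (c n) * cis ((\<mu> m - \<mu> n) * x)"
      by (simp only: complex_cnj_mult mult_ac)
  qed
  have cont: "continuous_on A ?f" for A
    by (intro continuous_intros)
  have "of_real (1 / (2 * L) * integral {-L..L} ?f) =
     (\<Sum>m\<in>S. \<Sum>n\<in>S. c m * cnj (c n) * (of_real (1 / (2 * L)) * integral {-L..L} (\<lambda>x. cis ((\<mu> m - \<mu> n) * x))))" for L
  proof -
    have "of_real (integral {-L..L} ?f) = integral {-L..L} (\<lambda>x. of_real (?f x) :: complex)"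
      by (rule integral_linear[OF integrable_continuous_interval[OF cont] bounded_linear_of_real,
            unfolded o_def, symmetric])
    also have "\<dots> = (\<Sum>m\<in>S. \<Sum>n\<in>S. c m * cnj (c n) * integral {-L..L} (\<lambda>x. cis ((\<mu> m - \<mu> n) * x)))"
    proof -
      have "(\<lambda>x. c m * cnj (c n) * cis ((\<mu> m - \<mu> n) * x)) integrable_on {-L..L}" for m n
        by (intro integrable_continuous_interval continuous_intros)
      then have "((\<lambda>x. \<Sum>m\<in>S. \<Sum>n\<in>S. c m * cnj (c n) * cis ((\<mu> m - \<mu> n) * x)) has_integral
          (\<Sum>m\<in>S. \<Sum>n\<in>S. integral {-L..L} (\<lambda>x. c m * cnj (c n) * cis ((\<mu> m - \<mu> n) * x)))) {-L..L}"
        by (intro has_integral_sum assms(1) integrable_integral)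
      then show ?thesis unfolding expand by (simp add: integral_unique)
    qed
    finally have "of_real (integral {-L..L} ?f)
      = (\<Sum>m\<in>S. \<Sum>n\<in>S. c m * cnj (c n) * integral {-L..L} (\<lambda>x. cis ((\<mu> m - \<mu> n) * x)))" .
    then show ?thesis unfolding of_real_mult by (simp only: sum_distrib_left mult.left_commute)
  qed
  moreover have "((\<lambda>L. \<Sum>m\<in>S. \<Sum>n\<in>S. c m * cnj (c n) * (of_real (1 / (2 * L)) * integral {-L..L} (\<lambda>x. cis ((\<mu> m - \<mu> n) * x))))
     \<longlongrightarrow> (\<Sum>m\<in>S. \<Sum>n\<in>S. c m * cnj (c n) * of_bool (\<mu> m - \<mu> n = 0))) at_top"
    by (intro tendsto_intros mean_cis_tendsto)
  moreover have "(\<Sum>m\<in>S. \<Sum>n\<in>S. c m * cnj (c n) * of_bool (\<mu> m - \<mu> n = 0)) = of_real (\<Sum>m\<in>S. (norm (c m))\<^sup>2)"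
  proof -
    have "(\<Sum>n\<in>S. c m * cnj (c n) * of_bool (\<mu> m - \<mu> n = 0)) = of_real ((norm (c m))\<^sup>2)" if "m \<in> S" for m
    proof -
      have "(\<Sum>n\<in>S. c m * cnj (c n) * of_bool (\<mu> m - \<mu> n = 0)) = (\<Sum>n\<in>S. if n = m then c m * cnj (c m) else 0)"
        using that assms(2) by (intro sum.cong) (auto dest: inj_onD)
      then show ?thesis using that assms(1) by (simp add: complex_norm_square[symmetric] del: of_real_power)
    qed
    then show ?thesis by simp
  qed
  ultimately have "((\<lambda>L. of_real (1 / (2 * L) * integral {-L..L} ?f) :: complex) \<longlongrightarrow> of_real (\<Sum>m\<in>S. (norm (c m))\<^sup>2)) at_top"
    by simp
  then show ?thesis by (simp only: tendsto_of_real_iff)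
qed

section \<open>The Fejer window and Schur's test\<close>

lemma has_integral_Fejer:
  fixes x :: real
  assumes "x \<noteq> 0"
  shows "((\<lambda>t. (1 - t) * cos (x * t)) has_integral ((1 - cos x) / x\<^sup>2)) {0..1}"
proof -
  have "((\<lambda>t. (1 - t) * cos (x * t)) has_integral
      ((1 - 1) * sin (x * 1) / x - cos (x * 1) / x\<^sup>2) - ((1 - 0) * sin (x * 0) / x - cos (x * 0) / x\<^sup>2)) {0..1}"
  proof (rule fundamental_theorem_of_calculus[where f = "\<lambda>t. (1 - t) * sin (x * t) / x - cos (x * t) / x\<^sup>2"])
    fix t :: real
    show "((\<lambda>t. (1 - t) * sin (x * t) / x - cos (x * t) / x\<^sup>2) has_vector_derivative (1 - t) * cos (x * t))
        (at t within {0..1})"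
      unfolding has_real_derivative_iff_has_vector_derivative[symmetric]
      using assms by (auto intro!: derivative_eq_intros simp: field_simps power2_eq_square)
  qed simp
  then show ?thesis by (simp add: diff_divide_distrib)
qed

text \<open>The weight \<open>1 - t\<close> is one half of the Fejer triangle. Its cosine transform
  \<open>(1 - cos x) / x^2\<close> decays quadratically, hence summably over the integers, whereas a
  sharp cutoff would give only \<open>1 / x\<close>. The first bound is the mass of the window and
  serves for small \<open>x\<close>.\<close>

lemma Fejer_integral_bound:
  fixes x :: real
  shows "\<bar>integral {0..1} (\<lambda>t. (1 - t) * cos (x * t))\<bar> \<le> 1 / 2"
    "x \<noteq> 0 \<Longrightarrow> \<bar>integral {0..1} (\<lambda>t. (1 - t) * cos (x * t))\<bar> \<le> 2 / x\<^sup>2"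
proof -
  have "((\<lambda>t. 1 - t) has_integral (1 - 1\<^sup>2 / 2) - (0 - 0\<^sup>2 / 2)) {0..1::real}"
  proof (rule fundamental_theorem_of_calculus)
    fix t :: real
    show "((\<lambda>t. t - t\<^sup>2 / 2) has_vector_derivative 1 - t) (at t within {0..1})"
      unfolding has_real_derivative_iff_has_vector_derivative[symmetric]
      by (rule derivative_eq_intros | simp)+
  qed simp
  then have *: "((\<lambda>t. 1 - t) has_integral 1 / 2) {0..1::real}" by simp
  have "norm (integral {0..1} (\<lambda>t. (1 - t) * cos (x * t))) \<le> integral {0..1::real} (\<lambda>t. 1 - t)"
  proof (intro integral_norm_bound_integral)
    show "(\<lambda>t. (1 - t) * cos (x * t)) integrable_on {0..1}"
      by (intro integrable_continuous_interval continuous_intros)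
    show "(\<lambda>t. 1 - t) integrable_on {0..1::real}" using * by blast
    fix t :: real assume "t \<in> {0..1}"
    then show "norm ((1 - t) * cos (x * t)) \<le> 1 - t"
      by (auto simp: abs_mult mult_left_le)
  qed
  then show "\<bar>integral {0..1} (\<lambda>t. (1 - t) * cos (x * t))\<bar> \<le> 1 / 2"
    using integral_unique[OF *] by simp
  assume "x \<noteq> 0"
  have "\<bar>1 - cos x\<bar> \<le> 2" using cos_ge_minus_one[of x] by simp
  then show "\<bar>integral {0..1} (\<lambda>t. (1 - t) * cos (x * t))\<bar> \<le> 2 / x\<^sup>2"
    by (simp add: integral_unique[OF has_integral_Fejer[OF \<open>x \<noteq> 0\<close>]] divide_right_mono)
qed

text \<open>On each side of \<open>i\<close> every distance is attained at most once, so each half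
  of the sum is part of the series for \<open>\<kappa>\<close>; hence the factor 2.\<close>

lemma sum_abs_diff_le_suminf:
  fixes \<kappa> :: "nat \<Rightarrow> real" and S :: "int set"
  assumes "summable \<kappa>" "\<And>n. \<kappa> n \<ge> 0" "finite S"
  shows "(\<Sum>j\<in>S. \<kappa> (nat \<bar>i - j\<bar>)) \<le> 2 * suminf \<kappa>"
proof -
  have half: "(\<Sum>j\<in>T. \<kappa> (nat \<bar>i - j\<bar>)) \<le> suminf \<kappa>" if "T \<subseteq> S" "inj_on (\<lambda>j. nat \<bar>i - j\<bar>) T" for T
  proof -
    have "(\<Sum>j\<in>T. \<kappa> (nat \<bar>i - j\<bar>)) = sum \<kappa> ((\<lambda>j. nat \<bar>i - j\<bar>) ` T)"
      using that(2) by (simp add: sum.reindex)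
    also have "\<dots> \<le> suminf \<kappa>"
      using assms that(1) by (intro sum_le_suminf) (auto intro: finite_subset)
    finally show ?thesis .
  qed
  have "S = {j \<in> S. j \<le> i} \<union> {j \<in> S. i < j}" by auto
  then have "(\<Sum>j\<in>S. \<kappa> (nat \<bar>i - j\<bar>))
      = (\<Sum>j\<in>{j \<in> S. j \<le> i}. \<kappa> (nat \<bar>i - j\<bar>)) + (\<Sum>j\<in>{j \<in> S. i < j}. \<kappa> (nat \<bar>i - j\<bar>))"
    using \<open>finite S\<close> by (subst sum.union_disjoint[symmetric]) auto
  also have "\<dots> \<le> suminf \<kappa> + suminf \<kappa>"
    by (intro add_mono half) (auto simp: inj_on_def)
  finally show ?thesis by simp
qed

text \<open>Schur's test: \<open>x i * x j\<close> is at most the mean of the two squares, and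
  symmetry of the kernel reduces both halves to the row sums bounded in
  \<open>sum_abs_diff_le_suminf\<close>.\<close>

lemma Schur_abs_diff:
  fixes \<kappa> :: "nat \<Rightarrow> real" and S :: "int set" and x :: "int \<Rightarrow> real"
  assumes "summable \<kappa>" "\<And>n. \<kappa> n \<ge> 0" "finite S"
  shows "(\<Sum>i\<in>S. \<Sum>j\<in>S. x i * x j * \<kappa> (nat \<bar>i - j\<bar>)) \<le> 2 * suminf \<kappa> * (\<Sum>i\<in>S. (x i)\<^sup>2)"
proof -
  have "x i * x j * \<kappa> (nat \<bar>i - j\<bar>)
      \<le> (x i)\<^sup>2 * \<kappa> (nat \<bar>i - j\<bar>) / 2 + (x j)\<^sup>2 * \<kappa> (nat \<bar>j - i\<bar>) / 2" for i j
    using mult_right_mono[OF sum_squares_bound[of "x i" "x j"] assms(2)[of "nat \<bar>i - j\<bar>"]]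
    by (simp add: algebra_simps abs_minus_commute)
  then have "(\<Sum>i\<in>S. \<Sum>j\<in>S. x i * x j * \<kappa> (nat \<bar>i - j\<bar>))
      \<le> (\<Sum>i\<in>S. \<Sum>j\<in>S. (x i)\<^sup>2 * \<kappa> (nat \<bar>i - j\<bar>) / 2 + (x j)\<^sup>2 * \<kappa> (nat \<bar>j - i\<bar>) / 2)"
    by (intro sum_mono)
  also have "\<dots> = (\<Sum>i\<in>S. \<Sum>j\<in>S. (x i)\<^sup>2 * \<kappa> (nat \<bar>i - j\<bar>) / 2)
      + (\<Sum>i\<in>S. \<Sum>j\<in>S. (x j)\<^sup>2 * \<kappa> (nat \<bar>j - i\<bar>) / 2)"
    by (simp add: sum.distrib)
  also have "(\<Sum>i\<in>S. \<Sum>j\<in>S. (x j)\<^sup>2 * \<kappa> (nat \<bar>j - i\<bar>) / 2) = (\<Sum>i\<in>S. \<Sum>j\<in>S. (x i)\<^sup>2 * \<kappa> (nat \<bar>i - j\<bar>) / 2)"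
    by (rule sum.swap)
  also have "(\<Sum>i\<in>S. \<Sum>j\<in>S. (x i)\<^sup>2 * \<kappa> (nat \<bar>i - j\<bar>) / 2) + (\<Sum>i\<in>S. \<Sum>j\<in>S. (x i)\<^sup>2 * \<kappa> (nat \<bar>i - j\<bar>) / 2)
      = (\<Sum>i\<in>S. (x i)\<^sup>2 * (\<Sum>j\<in>S. \<kappa> (nat \<bar>i - j\<bar>)))"
    by (simp add: sum_distrib_left sum.distrib[symmetric])
  also have "\<dots> \<le> (\<Sum>i\<in>S. (x i)\<^sup>2 * (2 * suminf \<kappa>))"
    by (intro sum_mono mult_left_mono sum_abs_diff_le_suminf assms) auto
  finally show ?thesis by (simp add: sum_distrib_left mult_ac)
qed

text \<open>The kernel sees an index only through \<open>p\<close>, so summing \<open>b\<close> over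
  the fibres of \<open>p\<close> turns the form into one on integers. The large sieve uses it with
  integer parts of frequencies, the summation over scales with dyadic levels.\<close>

lemma Schur_abs_diff_fibres:
  fixes \<kappa> :: "nat \<Rightarrow> real" and p :: "'i \<Rightarrow> int" and b :: "'i \<Rightarrow> real"
  assumes "summable \<kappa>" "\<And>n. \<kappa> n \<ge> 0" "finite S"
  shows "(\<Sum>k\<in>S. \<Sum>l\<in>S. b k * b l * \<kappa> (nat \<bar>p k - p l\<bar>))
     \<le> 2 * suminf \<kappa> * (\<Sum>j\<in>p ` S. (\<Sum>k | k \<in> S \<and> p k = j. b k)\<^sup>2)"
proof -
  define T where "T = (\<lambda>j. \<Sum>k | k \<in> S \<and> p k = j. b k)"
  have "(\<Sum>k\<in>S. \<Sum>l\<in>S. b k * b l * \<kappa> (nat \<bar>p k - p l\<bar>))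
      = (\<Sum>i\<in>p ` S. \<Sum>k | k \<in> S \<and> p k = i. \<Sum>j\<in>p ` S. \<Sum>l | l \<in> S \<and> p l = j. b k * b l * \<kappa> (nat \<bar>p k - p l\<bar>))"
    using \<open>finite S\<close> by (simp only: sum.image_gen[of S _ p, symmetric])
  also have "\<dots> = (\<Sum>i\<in>p ` S. \<Sum>j\<in>p ` S. \<Sum>k | k \<in> S \<and> p k = i. \<Sum>l | l \<in> S \<and> p l = j. b k * b l * \<kappa> (nat \<bar>p k - p l\<bar>))"
    by (intro sum.cong refl sum.swap)
  also have "\<dots> = (\<Sum>i\<in>p ` S. \<Sum>j\<in>p ` S. T i * T j * \<kappa> (nat \<bar>i - j\<bar>))"
  proof (intro sum.cong refl)
    fix i j
    have "T i * T j * \<kappa> (nat \<bar>i - j\<bar>) = (\<Sum>k | k \<in> S \<and> p k = i. \<Sum>l | l \<in> S \<and> p l = j. b k * b l * \<kappa> (nat \<bar>i - j\<bar>))"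
      unfolding T_def sum_product by (simp only: sum_distrib_right)
    also have "\<dots> = (\<Sum>k | k \<in> S \<and> p k = i. \<Sum>l | l \<in> S \<and> p l = j. b k * b l * \<kappa> (nat \<bar>p k - p l\<bar>))"
      by (intro sum.cong refl) auto
    finally show "(\<Sum>k | k \<in> S \<and> p k = i. \<Sum>l | l \<in> S \<and> p l = j. b k * b l * \<kappa> (nat \<bar>p k - p l\<bar>))
        = T i * T j * \<kappa> (nat \<bar>i - j\<bar>)" by simp
  qed
  also have "\<dots> \<le> 2 * suminf \<kappa> * (\<Sum>i\<in>p ` S. (T i)\<^sup>2)"
    using assms by (intro Schur_abs_diff) auto
  finally show ?thesis by (simp add: T_def)
qed

text \<open>The window \<open>2 * (1 - \<bar>u - 1/2\<bar>)\<close>, centred at \<open>1/2\<close>,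
  is at least 1 on \<open>{0..1}\<close>; nonnegativity of \<open>f\<close> allows adding the rest
  of its support \<open>{-1/2..3/2}\<close>.\<close>

lemma integral_unit_le_Fejer:
  fixes f :: "real \<Rightarrow> real"
  assumes "continuous_on UNIV f" "\<And>t. f t \<ge> 0"
  shows "integral {0..1} f \<le> 2 * integral {0..1} (\<lambda>t. (1 - t) * (f (1 / 2 + t) + f (1 / 2 - t)))"
proof -
  have cont: "continuous_on A f" for A
    using assms(1) continuous_on_subset by blast
  have int: "(\<lambda>t. f (1 / 2 + t)) integrable_on {a..b}" "(\<lambda>t. f (1 / 2 - t)) integrable_on {a..b}"
    "(\<lambda>t. (1 - t) * (f (1 / 2 + t) + f (1 / 2 - t))) integrable_on {a..b}" for a b
    by (intro integrable_continuous_interval continuous_intros continuous_on_compose2[OF assms(1)]; simp)+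
  have "integral {0..1} f = integral {0..1 / 2} f + integral {1 / 2..1} f"
    by (rule Henstock_Kurzweil_Integration.integral_combine[symmetric])
       (auto intro: integrable_continuous_interval cont)
  also have "integral {1 / 2..1} f = integral {0..1 / 2} (\<lambda>t. f (1 / 2 + t))"
    using integral_shift_real_ivl[of "1/2" "1/2" 1 f] by (simp add: add.commute)
  also have "integral {0..1 / 2} f = integral {0..1 / 2} (\<lambda>t. f (1 / 2 - t))"
  proof -
    have "integral {0..1 / 2} f = integral {- (1 / 2)..0} (\<lambda>t. f (t + 1 / 2))"
      using integral_shift_real_ivl[of 0 "1/2" "1/2" f] by simp
    also have "\<dots> = integral {0..1 / 2} (\<lambda>t. f (- t + 1 / 2))"
      using Henstock_Kurzweil_Integration.integral_reflect_real[of 0 "- (1/2)" "\<lambda>t. f (t + 1 / 2)"] by simp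
    finally show ?thesis by simp
  qed
  also have "integral {0..1 / 2} (\<lambda>t. f (1 / 2 - t)) + integral {0..1 / 2} (\<lambda>t. f (1 / 2 + t))
      = integral {0..1 / 2} (\<lambda>t. f (1 / 2 + t) + f (1 / 2 - t))"
    by (subst Henstock_Kurzweil_Integration.integral_add[OF int(1,2)]) simp
  also have "\<dots> \<le> integral {0..1 / 2} (\<lambda>t. 2 * ((1 - t) * (f (1 / 2 + t) + f (1 / 2 - t))))"
  proof (rule integral_le)
    fix t :: real assume "t \<in> {0..1 / 2}"
    then have "1 * (f (1 / 2 + t) + f (1 / 2 - t)) \<le> (2 * (1 - t)) * (f (1 / 2 + t) + f (1 / 2 - t))"
      using assms(2) by (intro mult_right_mono) auto
    then show "f (1 / 2 + t) + f (1 / 2 - t) \<le> 2 * ((1 - t) * (f (1 / 2 + t) + f (1 / 2 - t)))" by (simp only: mult.assoc mult_1)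
  qed (intro integrable_add integrable_on_mult_right int)+
  also have "\<dots> \<le> integral {0..1} (\<lambda>t. 2 * ((1 - t) * (f (1 / 2 + t) + f (1 / 2 - t))))"
    by (rule integral_subset_le) (use assms(2) in \<open>auto intro: integrable_on_mult_right int\<close>)
  finally show ?thesis by simp
qed

lemma summable_divide_Suc_square: "summable (\<lambda>n. c / (real (Suc n))\<^sup>2)" for c :: real
proof -
  have "summable (\<lambda>n. inverse ((real (Suc n))\<^sup>2))"
    using inverse_power_summable[of 2, where 'a=real]
    by (simp add: summable_Suc_iff[of "\<lambda>n. inverse ((real n)\<^sup>2)"] del: of_nat_Suc)
  then show ?thesis unfolding divide_inverse by (rule summable_mult)
qed

text \<open>Terms whose frequencies have distant integer parts are almost orthogonal under the
  window, and those with the same integer part are summed in modulus. The factor 4 is 2 from the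
  window times 2 from Schur's test.\<close>

lemma large_sieve_unit_interval:
  fixes d :: "'i \<Rightarrow> complex" and h :: "'i \<Rightarrow> real"
  assumes "finite S"
  shows "integral {0..1} (\<lambda>t. (norm (\<Sum>k\<in>S. d k * cis (2 * pi * h k * t)))\<^sup>2)
     \<le> 4 * (\<Sum>n. 9 / (real (Suc n))\<^sup>2) * (\<Sum>j\<in>(\<lambda>k. \<lfloor>h k\<rfloor>) ` S. (\<Sum>k | k \<in> S \<and> \<lfloor>h k\<rfloor> = j. norm (d k))\<^sup>2)"
proof -
  \<comment> \<open>The 9 covers both regimes: \<open>\<kappa> n\<close> is at least 1 for
    \<open>n \<le> 2\<close>, where the trivial bound is used, and
    \<open>n + 1 \<le> 3 * (n - 1)\<close> for larger \<open>n\<close>, where \<open>n - 1\<close>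
    bounds the frequency gap from below.\<close>
  define \<kappa> where "\<kappa> = (\<lambda>n. 9 / (real (Suc n))\<^sup>2)"
  define f where "f = (\<lambda>t. (norm (\<Sum>k\<in>S. d k * cis (2 * pi * h k * t)))\<^sup>2)"
  define x where "x = (\<lambda>k l. 2 * pi * (h k - h l))"
  \<comment> \<open>The phase \<open>cis (x k l / 2)\<close> comes from centring the window at
    \<open>1/2\<close>; it has modulus one and disappears when absolute values are taken.\<close>
  define e where "e = (\<lambda>k l. d k * cnj (d l) * cis (x k l / 2))"
  define G where "G = (\<lambda>x::real. integral {0..1} (\<lambda>t. (1 - t) * cos (x * t)))"
  have sum\<kappa>: "summable \<kappa>"
    unfolding \<kappa>_def by (rule summable_divide_Suc_square)
  have pos\<kappa>: "\<kappa> n \<ge> 0" for n by (simp add: \<kappa>_def)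
  have cont: "continuous_on UNIV f" unfolding f_def by (intro continuous_intros)
  have f_expand: "of_real (f t) = (\<Sum>k\<in>S. \<Sum>l\<in>S. d k * cnj (d l) * cis (x k l * t))" for t
    unfolding f_def norm_sum_square_expand
  proof (intro sum.cong refl)
    fix k l
    have "cis (x k l * t) = cis (2 * pi * h k * t) * cnj (cis (2 * pi * h l * t))"
      by (simp add: cis_cnj cis_mult x_def algebra_simps)
    then show "d k * cis (2 * pi * h k * t) * cnj (d l * cis (2 * pi * h l * t)) = d k * cnj (d l) * cis (x k l * t)"
      by (simp only: complex_cnj_mult mult_ac)
  qed
  \<comment> \<open>Pairing the points \<open>1/2 + t\<close> and \<open>1/2 - t\<close> turns each
    character into a phase times a cosine, to which the Fejer integral applies.\<close>
  have f_sym: "f (1 / 2 + t) + f (1 / 2 - t) = (\<Sum>k\<in>S. \<Sum>l\<in>S. Re (e k l) * (2 * cos (x k l * t)))" for t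
  proof -
    have "cis (y * (1 / 2 + t)) + cis (y * (1 / 2 - t)) = cis (y / 2) * of_real (2 * cos (y * t))" for y
    proof -
      have "cis (y * (1 / 2 + t)) = cis (y / 2) * cis (y * t)" "cis (y * (1 / 2 - t)) = cis (y / 2) * cis (- (y * t))"
        by (simp_all add: cis_mult algebra_simps)
      moreover have "cis (y * t) + cis (- (y * t)) = of_real (2 * cos (y * t))"
        by (simp add: complex_eq_iff)
      ultimately show ?thesis by (simp only: distrib_left[symmetric])
    qed
    then have "complex_of_real (f (1 / 2 + t) + f (1 / 2 - t))
        = (\<Sum>k\<in>S. \<Sum>l\<in>S. e k l * of_real (2 * cos (x k l * t)))"
      unfolding of_real_add f_expand sum.distrib[symmetric] distrib_left[symmetric] e_def
      by (simp only: mult.assoc)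
    then have "f (1 / 2 + t) + f (1 / 2 - t) = Re (\<Sum>k\<in>S. \<Sum>l\<in>S. e k l * of_real (2 * cos (x k l * t)))"
      by (metis Re_complex_of_real)
    then show ?thesis by simp
  qed
  have "((\<lambda>t. \<Sum>k\<in>S. \<Sum>l\<in>S. 2 * Re (e k l) * ((1 - t) * cos (x k l * t))) has_integral
      (\<Sum>k\<in>S. \<Sum>l\<in>S. 2 * Re (e k l) * G (x k l))) {0..1}"
    unfolding G_def
    by (intro has_integral_sum assms has_integral_mult_right integrable_integral
        integrable_continuous_interval continuous_intros)
  then have "integral {0..1} (\<lambda>t. (1 - t) * (f (1 / 2 + t) + f (1 / 2 - t))) = (\<Sum>k\<in>S. \<Sum>l\<in>S. 2 * Re (e k l) * G (x k l))"
    unfolding f_sym by (simp add: sum_distrib_left mult_ac integral_unique)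
  also have "\<dots> \<le> (\<Sum>k\<in>S. \<Sum>l\<in>S. norm (d k) * norm (d l) * \<kappa> (nat \<bar>\<lfloor>h k\<rfloor> - \<lfloor>h l\<rfloor>\<bar>))"
  proof (intro sum_mono)
    fix k l
    let ?D = "nat \<bar>\<lfloor>h k\<rfloor> - \<lfloor>h l\<rfloor>\<bar>"
    have "2 * \<bar>G (x k l)\<bar> \<le> \<kappa> ?D"
    proof (cases "?D \<le> 2")
      case True
      then have "(real (Suc ?D))\<^sup>2 \<le> 3\<^sup>2" by (intro power_mono) linarith+
      then have "\<kappa> ?D \<ge> 1" unfolding \<kappa>_def by (simp add: divide_simps del: of_nat_Suc)
      then show ?thesis using Fejer_integral_bound(1)[of "x k l"] by (simp add: G_def)
    next
      case False
      define \<xi> where "\<xi> = \<bar>h k - h l\<bar>"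
      have "\<xi> \<ge> real ?D - 1" unfolding \<xi>_def by linarith
      moreover have "real (Suc n) \<le> 3 * (real n - 1)" if "\<not> n \<le> 2" for n
        using that of_nat_le_iff[of 3 n, where 'a=real] by simp
      ultimately have 1: "real (Suc ?D) \<le> 3 * \<xi>"
        using False by (meson dual_order.trans mult_left_mono zero_le_numeral)
      have pos: "\<xi> > 0"
        using order.strict_trans2[OF _ 1, of 0] by (simp add: zero_less_mult_iff del: of_nat_Suc)
      have "(real (Suc ?D))\<^sup>2 \<le> 9 * \<xi>\<^sup>2"
        using power_mono[OF 1, of 2] by (simp add: power_mult_distrib)
      then have "1 / \<xi>\<^sup>2 \<le> \<kappa> ?D"
        using pos by (simp add: \<kappa>_def divide_simps)
      have "2 * \<bar>G (x k l)\<bar> \<le> 2 * (2 / (x k l)\<^sup>2)"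
        unfolding G_def using pos by (intro mult_left_mono Fejer_integral_bound(2)) (auto simp: x_def \<xi>_def)
      also have "\<dots> = 1 / (pi\<^sup>2 * \<xi>\<^sup>2)"
        by (simp add: x_def \<xi>_def power_mult_distrib)
      also have "\<dots> \<le> 1 / \<xi>\<^sup>2"
      proof -
        have "1 \<le> pi\<^sup>2" using pi_gt3 by (simp add: one_le_power)
        then show ?thesis using pos by (intro divide_left_mono) auto
      qed
      finally show ?thesis using \<open>1 / \<xi>\<^sup>2 \<le> \<kappa> ?D\<close> by linarith
    qed
    have "2 * Re (e k l) * G (x k l) \<le> \<bar>Re (e k l)\<bar> * (2 * \<bar>G (x k l)\<bar>)"
      using abs_ge_self[of "2 * Re (e k l) * G (x k l)"] by (simp add: abs_mult mult_ac)
    also have "\<dots> \<le> norm (d k) * norm (d l) * \<kappa> ?D"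
    proof (intro mult_mono)
      show "\<bar>Re (e k l)\<bar> \<le> norm (d k) * norm (d l)"
        using abs_Re_le_cmod[of "e k l"] by (simp add: e_def norm_mult)
    qed (use \<open>2 * \<bar>G (x k l)\<bar> \<le> \<kappa> ?D\<close> in auto)
    finally show "2 * Re (e k l) * G (x k l) \<le> norm (d k) * norm (d l) * \<kappa> ?D" .
  qed
  also have "\<dots> \<le> 2 * suminf \<kappa> * (\<Sum>j\<in>(\<lambda>k. \<lfloor>h k\<rfloor>) ` S. (\<Sum>k | k \<in> S \<and> \<lfloor>h k\<rfloor> = j. norm (d k))\<^sup>2)"
    by (rule Schur_abs_diff_fibres[OF sum\<kappa> pos\<kappa> assms])
  finally show ?thesis
    using integral_unit_le_Fejer[OF cont] unfolding f_def \<kappa>_def by simp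
qed

section \<open>Summation of dyadic pairs\<close>

lemma L2_set_sum_le:
  assumes "finite P"
  shows "L2_set (\<lambda>i. \<Sum>p\<in>P. f p i) A \<le> (\<Sum>p\<in>P. L2_set (f p) A)"
  using assms
proof induction
  case empty
  show ?case by (simp add: L2_set_def)
next
  case (insert p P)
  have "L2_set (\<lambda>i. \<Sum>p\<in>insert p P. f p i) A = L2_set (\<lambda>i. f p i + (\<Sum>p\<in>P. f p i)) A"
    using insert.hyps by simp
  also have "\<dots> \<le> L2_set (f p) A + L2_set (\<lambda>i. \<Sum>p\<in>P. f p i) A"
    by (rule L2_set_triangle_ineq)
  finally show ?case using insert by simp
qed

text \<open>Cauchy-Schwarz on a fibre costs the square root of the count,
  \<open>sqrt C * \<theta> ^ (2 * min n1 n2)\<close> for levels \<open>n1\<close> and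
  \<open>n2\<close>. Since the weights supply \<open>\<theta> ^ (n1 + n2)\<close>, a factor
  \<open>(1 / \<theta>) ^ \<bar>n1 - n2\<bar>\<close> is left over, and Schur's test sums over all
  pairs of levels.\<close>

lemma dyadic_bilinear_bound:
  fixes B :: "'k \<Rightarrow> real" and lev :: "'k \<Rightarrow> nat" and g :: "'k \<times> 'k \<Rightarrow> 'i" and \<theta> C :: real
  assumes "finite S" "\<theta> > 1" "C \<ge> 0"
    and count: "\<And>i n1 n2. real (card {p \<in> S \<times> S. g p = i \<and> lev (fst p) = n1 \<and> lev (snd p) = n2})
       \<le> C * \<theta> ^ (4 * min n1 n2)"
  shows "(\<Sum>i\<in>g ` (S \<times> S). (\<Sum>p | p \<in> S \<times> S \<and> g p = i. B (fst p) * B (snd p))\<^sup>2)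
     \<le> C * (2 * (\<Sum>n. (1 / \<theta>) ^ n))\<^sup>2 * (\<Sum>k\<in>S. \<theta> ^ (2 * lev k) * (B k)\<^sup>2)\<^sup>2"
proof -
  define N where "N = lev ` S"
  define I where "I = g ` (S \<times> S)"
  define lv where "lv = (\<lambda>p. (lev (fst p), lev (snd p)))"
  define F where "F = (\<lambda>p. B (fst p) * B (snd p))"
  define X where "X = (\<lambda>q i. \<Sum>p | p \<in> {p \<in> S \<times> S. g p = i} \<and> lv p = q. F p)"
  define A where "A = (\<lambda>n. \<Sum>k | k \<in> S \<and> lev k = n. (B k)\<^sup>2)"
  \<comment> \<open>\<open>D n\<close> is the weighted norm of the block of level \<open>n\<close>;
    the squares of these norms add up to the sum on the right of the claim.\<close>
  define D where "D = (\<lambda>n. \<theta> ^ n * sqrt (A n))"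
  have A0: "A n \<ge> 0" for n by (simp add: A_def sum_nonneg)
  have fin: "finite N" "finite I" "finite (S \<times> S)" using \<open>finite S\<close> by (auto simp: N_def I_def)
  have inner: "(\<Sum>p | p \<in> S \<times> S \<and> g p = i. F p) = (\<Sum>q\<in>N \<times> N. X q i)" for i
    unfolding X_def by (rule sum.group[symmetric]) (use fin in \<open>auto simp: lv_def N_def\<close>)
  have L2X: "L2_set (X (n1, n2)) I \<le> sqrt C * (D n1 * D n2 * (1 / \<theta>) ^ nat \<bar>int n1 - int n2\<bar>)" for n1 n2
  proof -
    let ?m = "min n1 n2"
    have "(\<Sum>i\<in>I. (X (n1, n2) i)\<^sup>2)
        \<le> (\<Sum>i\<in>I. C * \<theta> ^ (4 * ?m) * (\<Sum>p | p \<in> {p \<in> S \<times> S. lv p = (n1, n2)} \<and> g p = i. (F p)\<^sup>2))"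
    proof (rule sum_mono)
      fix i
      let ?P = "{p. p \<in> {p \<in> S \<times> S. g p = i} \<and> lv p = (n1, n2)}"
      have "(X (n1, n2) i)\<^sup>2 \<le> (\<Sum>p\<in>?P. (F p)\<^sup>2) * card ?P"
        unfolding X_def using sum_squared_le_sum_of_squares by blast
      also have "\<dots> \<le> (\<Sum>p\<in>?P. (F p)\<^sup>2) * (C * \<theta> ^ (4 * ?m))"
        using count[of i n1 n2] by (intro mult_left_mono sum_nonneg) (auto simp: lv_def conj_ac)
      also have "?P = {p. p \<in> {p \<in> S \<times> S. lv p = (n1, n2)} \<and> g p = i}" by auto
      finally show "(X (n1, n2) i)\<^sup>2
          \<le> C * \<theta> ^ (4 * ?m) * (\<Sum>p | p \<in> {p \<in> S \<times> S. lv p = (n1, n2)} \<and> g p = i. (F p)\<^sup>2)"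
        by (simp add: mult_ac)
    qed
    also have "\<dots> = C * \<theta> ^ (4 * ?m) * (\<Sum>p | p \<in> S \<times> S \<and> lv p = (n1, n2). (F p)\<^sup>2)"
      unfolding sum_distrib_left[symmetric]
      by (subst sum.group) (use fin in \<open>auto simp: I_def\<close>)
    \<comment> \<open>Summation over \<open>i\<close> has removed the constraint on
      \<open>g\<close>, so the pairs form a product set and the square sum factors.\<close>
    also have "{p. p \<in> S \<times> S \<and> lv p = (n1, n2)} = {k \<in> S. lev k = n1} \<times> {k \<in> S. lev k = n2}"
      by (auto simp: lv_def)
    also have "(\<Sum>p\<in>{k \<in> S. lev k = n1} \<times> {k \<in> S. lev k = n2}. (F p)\<^sup>2) = A n1 * A n2"
      unfolding A_def F_def by (simp add: sum_product sum.cartesian_product power_mult_distrib case_prod_unfold)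
    finally have "L2_set (X (n1, n2)) I \<le> sqrt (C * \<theta> ^ (4 * ?m) * (A n1 * A n2))"
      unfolding L2_set_def by (rule real_sqrt_le_mono)
    also have "\<dots> = sqrt C * (\<theta> ^ (2 * ?m) * (sqrt (A n1) * sqrt (A n2)))"
    proof -
      have "sqrt (\<theta> ^ (4 * ?m)) = \<theta> ^ (2 * ?m)"
        using \<open>\<theta> > 1\<close> by (intro real_sqrt_unique) (auto simp flip: power_mult)
      then show ?thesis by (simp add: real_sqrt_mult)
    qed
    also have "\<theta> ^ (2 * ?m) = \<theta> ^ n1 * \<theta> ^ n2 * (1 / \<theta>) ^ nat \<bar>int n1 - int n2\<bar>"
    proof -
      have "n1 + n2 = 2 * ?m + nat \<bar>int n1 - int n2\<bar>" by (auto simp: min_def)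
      then have "\<theta> ^ n1 * \<theta> ^ n2 = \<theta> ^ (2 * ?m) * \<theta> ^ nat \<bar>int n1 - int n2\<bar>"
        by (metis power_add)
      then show ?thesis using \<open>\<theta> > 1\<close> by (simp add: power_one_over)
    qed
    finally show ?thesis by (simp add: D_def mult_ac)
  qed
  have "sqrt (\<Sum>i\<in>I. (\<Sum>p | p \<in> S \<times> S \<and> g p = i. F p)\<^sup>2) = L2_set (\<lambda>i. \<Sum>q\<in>N \<times> N. X q i) I"
    by (simp add: L2_set_def inner)
  also have "\<dots> \<le> (\<Sum>q\<in>N \<times> N. L2_set (X q) I)"
    using fin by (intro L2_set_sum_le) auto
  also have "\<dots> = (\<Sum>n1\<in>N. \<Sum>n2\<in>N. L2_set (X (n1, n2)) I)"
    by (simp add: sum.cartesian_product)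
  also have "\<dots> \<le> (\<Sum>n1\<in>N. \<Sum>n2\<in>N. sqrt C * (D n1 * D n2 * (1 / \<theta>) ^ nat \<bar>int n1 - int n2\<bar>))"
    by (intro sum_mono L2X)
  also have "\<dots> = sqrt C * (\<Sum>n1\<in>N. \<Sum>n2\<in>N. D n1 * D n2 * (1 / \<theta>) ^ nat \<bar>int n1 - int n2\<bar>)"
    by (simp add: sum_distrib_left)
  also have "\<dots> \<le> sqrt C * (2 * (\<Sum>n. (1 / \<theta>) ^ n) * (\<Sum>j\<in>int ` N. (\<Sum>k | k \<in> N \<and> int k = j. D k)\<^sup>2))"
    by (intro mult_left_mono Schur_abs_diff_fibres) (use fin \<open>\<theta> > 1\<close> \<open>C \<ge> 0\<close> in \<open>auto intro: summable_geometric\<close>)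
  also have "(\<Sum>j\<in>int ` N. (\<Sum>k | k \<in> N \<and> int k = j. D k)\<^sup>2) = (\<Sum>n\<in>N. (D n)\<^sup>2)"
  proof -
    have "{k. k \<in> N \<and> k = n} = {n}" if "n \<in> N" for n using that by auto
    then show ?thesis by (simp add: sum.reindex cong: sum.cong)
  qed
  also have "\<dots> = (\<Sum>n\<in>N. \<Sum>k | k \<in> S \<and> lev k = n. \<theta> ^ (2 * lev k) * (B k)\<^sup>2)"
  proof (rule sum.cong[OF refl])
    fix n
    show "(D n)\<^sup>2 = (\<Sum>k | k \<in> S \<and> lev k = n. \<theta> ^ (2 * lev k) * (B k)\<^sup>2)"
      using A0[of n] by (simp add: D_def power_mult_distrib flip: power_mult)
        (simp add: A_def sum_distrib_left mult.commute)
  qed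
  also have "\<dots> = (\<Sum>k\<in>S. \<theta> ^ (2 * lev k) * (B k)\<^sup>2)"
    by (rule sum.group) (use fin \<open>finite S\<close> in \<open>auto simp: N_def\<close>)
  finally have *: "sqrt (\<Sum>i\<in>I. (\<Sum>p | p \<in> S \<times> S \<and> g p = i. F p)\<^sup>2)
      \<le> sqrt C * (2 * (\<Sum>n. (1 / \<theta>) ^ n) * (\<Sum>k\<in>S. \<theta> ^ (2 * lev k) * (B k)\<^sup>2))" .
  have "(\<Sum>i\<in>I. (\<Sum>p | p \<in> S \<times> S \<and> g p = i. F p)\<^sup>2)
      = (sqrt (\<Sum>i\<in>I. (\<Sum>p | p \<in> S \<times> S \<and> g p = i. F p)\<^sup>2))\<^sup>2"
    by (simp add: sum_nonneg)
  also have "\<dots> \<le> (sqrt C * (2 * (\<Sum>n. (1 / \<theta>) ^ n) * (\<Sum>k\<in>S. \<theta> ^ (2 * lev k) * (B k)\<^sup>2)))\<^sup>2"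
    by (intro power_mono * real_sqrt_ge_zero sum_nonneg) auto
  also have "\<dots> = C * (2 * (\<Sum>n. (1 / \<theta>) ^ n))\<^sup>2 * (\<Sum>k\<in>S. \<theta> ^ (2 * lev k) * (B k)\<^sup>2)\<^sup>2"
    using \<open>C \<ge> 0\<close> by (simp add: power_mult_distrib)
  finally show ?thesis by (simp add: I_def F_def)
qed

section \<open>Counting lattice points in level sets\<close>

text \<open>By convexity after subtracting the parabola, consecutive secant slopes of
  \<open>g\<close> grow by at least \<open>lam / 2\<close> times the total length. Three points with
  gaps above \<open>d\<close> would have both slopes below \<open>1 / d\<close> in modulus but a
  slope increase of at least \<open>lam * d\<close>, impossible when
  \<open>lam * d^2 \<ge> 2\<close>. So no such triple exists, and two intervals suffice.\<close>

lemma convex_level_cover: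
  fixes g :: "real \<Rightarrow> real"
  assumes conv: "convex_on I (\<lambda>y. g y - lam / 2 * y\<^sup>2)" and "d > 0" "lam * d\<^sup>2 \<ge> 2"
    and X: "finite X" "X \<subseteq> I" and close: "\<And>x y. x \<in> X \<Longrightarrow> y \<in> X \<Longrightarrow> \<bar>g x - g y\<bar> \<le> 1"
  shows "\<exists>u v. X \<subseteq> {u..u + d} \<union> {v..v + d}"
proof -
  have False if "x \<in> X" "y \<in> X" "z \<in> X" "x + d < y" "y + d < z" for x y z
  proof -
    define G where "G = (\<lambda>y. g y - lam / 2 * y\<^sup>2)"
    have "x < y" "y < z" using that \<open>d > 0\<close> by auto
    \<comment> \<open>The secant slope over the whole of \<open>{x..z}\<close> lies between the
      slopes over its two parts.\<close>
    have "(G x - G y) / (x - y) \<le> (G y - G z) / (y - z)"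
    proof -
      have "convex_on I G" using conv by (simp add: G_def)
      then have "(G x - G y) / (x - y) \<le> (G x - G z) / (x - z)" "(G x - G z) / (x - z) \<le> (G y - G z) / (y - z)"
        using convex_on_slope_le[of I G x z y] that X \<open>x < y\<close> \<open>y < z\<close> by auto
      then show ?thesis by linarith
    qed
    moreover have "(G x - G y) / (x - y) = (g x - g y) / (x - y) - lam / 2 * (x + y)"
      "(G y - G z) / (y - z) = (g y - g z) / (y - z) - lam / 2 * (y + z)"
      using \<open>x < y\<close> \<open>y < z\<close> by (auto simp: G_def field_simps power2_eq_square)
    ultimately have *: "lam / 2 * (z - x) \<le> (g y - g z) / (y - z) - (g x - g y) / (x - y)"
      unfolding right_diff_distrib distrib_left by linarith
    have quot: "\<bar>(g p - g q) / (p - q)\<bar> < 1 / d" if "p \<in> X" "q \<in> X" "p + d < q" for p q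
    proof -
      have "\<bar>(g p - g q) / (p - q)\<bar> \<le> 1 / \<bar>p - q\<bar>"
        using close[OF that(1,2)] by (simp add: abs_divide divide_right_mono)
      also have "\<dots> < 1 / d" using that(3) \<open>d > 0\<close> by (intro divide_strict_left_mono) auto
      finally show ?thesis .
    qed
    have "lam / 2 * (2 * d) < 2 / d"
    proof -
      have "lam > 0" using \<open>lam * d\<^sup>2 \<ge> 2\<close> \<open>d > 0\<close>
        by (smt (verit, ccfv_SIG) mult_nonpos_nonneg zero_le_power2)
      then have "lam / 2 * (2 * d) \<le> lam / 2 * (z - x)"
        using that by (intro mult_left_mono) auto
      moreover have "2 / d = 1 / d + 1 / d" by simp
      ultimately show ?thesis using * quot[OF that(1,2,4)] quot[OF that(2,3,5)] by linarith
    qed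
    then have "lam * d\<^sup>2 < 2" using \<open>d > 0\<close> by (simp add: field_simps power2_eq_square)
    then show False using \<open>lam * d\<^sup>2 \<ge> 2\<close> by simp
  qed
  note * = this
  show ?thesis
  proof (cases "X = {}")
    case False
    \<comment> \<open>Greedy choice: one interval starts at \<open>Min X\<close> and the second at
      the first point it misses; a point beyond both would complete a forbidden triple.\<close>
    define Y where "Y = {x \<in> X. Min X + d < x}"
    have "finite Y" using X by (simp add: Y_def)
    have sub: "x \<in> {Min X..Min X + d}" if "x \<in> X" "x \<notin> Y" for x
      using that X by (auto simp: Y_def)
    show ?thesis
    proof (cases "Y = {}")
      case True
      then have "X \<subseteq> {Min X..Min X + d}" using sub by auto
      then show ?thesis by blast
    next
      case False
      then have "Min Y \<in> Y" using \<open>finite Y\<close> by simp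
      then have "\<not> Min Y + d < x" if "x \<in> Y" for x
        using *[of "Min X" "Min Y" x] that X \<open>X \<noteq> {}\<close> by (auto simp: Y_def)
      then have "Y \<subseteq> {Min Y..Min Y + d}" using \<open>finite Y\<close> by (auto simp: not_less)
      then have "X \<subseteq> {Min X..Min X + d} \<union> {Min Y..Min Y + d}" using sub by blast
      then show ?thesis by blast
    qed
  qed auto
qed

text \<open>Once the signs \<open>s\<close> and \<open>s'\<close> of \<open>y\<close> and
  \<open>M - y\<close> are fixed, the absolute values become smooth powers. The second derivative of
  their sum is \<open>a * (a - 1)\<close> times a sum of two positive powers, and the power of
  \<open>y\<close> alone already gives the lower bound \<open>lam\<close>.\<close>

lemma level_set_piece_cover:
  fixes a lam d \<rho> \<rho>' M s s' :: real
  assumes a: "a > 0" "a \<noteq> 1" and s: "s \<in> {-1, 1}" "s' \<in> {-1, 1}"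
    and "\<rho> \<ge> 0" and lam: "\<And>y. \<rho> < y \<Longrightarrow> y < \<rho>' \<Longrightarrow> lam \<le> a * \<bar>a - 1\<bar> * y powr (a - 2)"
    and d: "d > 0" "lam * d\<^sup>2 \<ge> 2"
    and X: "finite X" "\<And>y. y \<in> X \<Longrightarrow> \<rho> < s * y \<and> s * y < \<rho>' \<and> 0 < s' * (M - y)"
      "\<And>y. y \<in> X \<Longrightarrow> \<lfloor>\<bar>y\<bar> powr a + \<bar>M - y\<bar> powr a\<rfloor> = j"
  shows "\<exists>u v. X \<subseteq> {u..u + d} \<union> {v..v + d}"
proof -
  define I where "I = {y. \<rho> < s * y \<and> s * y < \<rho>' \<and> 0 < s' * (M - y)}"
  \<comment> \<open>The sign turns the concave case \<open>a < 1\<close> into the convex one and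
    leaves the modulus of differences unchanged.\<close>
  define e where "e = sgn (a - 1)"
  define g where "g = (\<lambda>y. e * ((s * y) powr a + (s' * M - s' * y) powr a))"
  have pos: "s * y > 0" "s' * M - s' * y > 0" if "y \<in> I" for y
    using that \<open>\<rho> \<ge> 0\<close> by (auto simp: I_def right_diff_distrib)
  have ss: "s * s = 1" "s' * s' = 1" using s by auto
  have "convex_on I (\<lambda>y. g y - lam / 2 * y\<^sup>2)"
  proof (rule f''_ge0_imp_convex)
    have "I = (if s = 1 then {\<rho><..<\<rho>'} else {-\<rho>'<..<-\<rho>}) \<inter> (if s' = 1 then {..<M} else {M<..})"
      using s by (auto simp: I_def)
    then show "convex I" by (auto intro!: convex_Int)
  next
    fix y assume "y \<in> I"
    note pos = pos[OF this]
    have P: "((\<lambda>y. (s * y) powr r) has_real_derivative r * (s * y) powr (r - 1) * s) (at y)" for r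
      using DERIV_fun_powr[of "\<lambda>y. s * y" s y r] pos by (auto intro!: derivative_eq_intros)
    have Q: "((\<lambda>y. (s' * M - s' * y) powr r) has_real_derivative r * (s' * M - s' * y) powr (r - 1) * (- s')) (at y)" for r
      using DERIV_fun_powr[of "\<lambda>y. s' * M - s' * y" "- s'" y r] pos by (auto intro!: derivative_eq_intros)
    show "((\<lambda>y. g y - lam / 2 * y\<^sup>2) has_real_derivative
        e * (a * (s * y) powr (a - 1) * s + a * (s' * M - s' * y) powr (a - 1) * (- s')) - lam * y) (at y)"
      unfolding g_def
      by (rule DERIV_diff DERIV_cmult DERIV_add P Q)+ (auto intro!: derivative_eq_intros)
    have "((\<lambda>y. e * (a * (s * y) powr (a - 1) * s + a * (s' * M - s' * y) powr (a - 1) * (- s')) - lam * y) has_real_derivative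
        e * (a * ((a - 1) * (s * y) powr (a - 1 - 1) * s) * s + a * ((a - 1) * (s' * M - s' * y) powr (a - 1 - 1) * (- s')) * (- s')) - lam * 1) (at y)"
      by (rule DERIV_diff DERIV_cmult DERIV_cmult_right DERIV_add P Q DERIV_ident)+
    moreover have "e * (a * ((a - 1) * (s * y) powr (a - 1 - 1) * s) * s + a * ((a - 1) * (s' * M - s' * y) powr (a - 1 - 1) * (- s')) * (- s')) - lam * 1
      = a * \<bar>a - 1\<bar> * ((s * y) powr (a - 2) + (s' * M - s' * y) powr (a - 2)) - lam"
    proof -
      have e: "e * (a - 1) = \<bar>a - 1\<bar>" by (simp add: e_def mult.commute abs_sgn)
      have "e * (a * ((a - 1) * U * s) * s + a * ((a - 1) * V * (- s')) * (- s'))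
          = a * (e * (a - 1)) * (U * (s * s) + V * (s' * s'))" for U V
        by (simp add: algebra_simps)
      then show ?thesis by (simp add: ss e)
    qed
    ultimately show "((\<lambda>y. e * (a * (s * y) powr (a - 1) * s + a * (s' * M - s' * y) powr (a - 1) * (- s')) - lam * y) has_real_derivative
        a * \<bar>a - 1\<bar> * ((s * y) powr (a - 2) + (s' * M - s' * y) powr (a - 2)) - lam) (at y)" by simp
    have "lam \<le> a * \<bar>a - 1\<bar> * (s * y) powr (a - 2)"
      using \<open>y \<in> I\<close> by (intro lam) (auto simp: I_def)
    also have "\<dots> \<le> a * \<bar>a - 1\<bar> * ((s * y) powr (a - 2) + (s' * M - s' * y) powr (a - 2))"
      using a by (intro mult_left_mono) auto
    finally show "0 \<le> a * \<bar>a - 1\<bar> * ((s * y) powr (a - 2) + (s' * M - s' * y) powr (a - 2)) - lam" by simp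
  qed
  moreover have "X \<subseteq> I" using X by (auto simp: I_def)
  moreover have "\<bar>g x - g y\<bar> \<le> 1" if "x \<in> X" "y \<in> X" for x y
  proof -
    have g: "g z = e * (\<bar>z\<bar> powr a + \<bar>M - z\<bar> powr a)" if "z \<in> X" for z
    proof -
      have "s * z = \<bar>z\<bar>" "s' * M - s' * z = \<bar>M - z\<bar>"
        using pos[of z] that \<open>X \<subseteq> I\<close> s by auto
      then show ?thesis by (simp add: g_def)
    qed
    have "\<bar>e\<bar> = 1" using a by (simp add: e_def abs_sgn_eq)
    have "\<bar>p - q\<bar> \<le> 1" if "\<lfloor>p\<rfloor> = j" "\<lfloor>q\<rfloor> = j" for p q :: real
      using that by linarith
    from this[OF X(3)[OF that(1)] X(3)[OF that(2)]] show ?thesis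
      unfolding g[OF that(1)] g[OF that(2)] right_diff_distrib[symmetric] abs_mult \<open>\<bar>e\<bar> = 1\<close> by simp
  qed
  ultimately show ?thesis by (rule convex_level_cover[OF _ d X(1)])
qed

text \<open>The count 10 is two intervals for each of the four sign patterns, one for
  \<open>{-\<rho>..\<rho>}\<close>, which fits because \<open>d \<ge> 2 * \<rho>\<close>, and one
  for the point \<open>M\<close>.\<close>

lemma level_set_cover:
  fixes a lam d \<rho> \<rho>' M :: real
  assumes a: "a > 0" "a \<noteq> 1"
    and "\<rho> \<ge> 0" and lam: "\<And>y. \<rho> < y \<Longrightarrow> y < \<rho>' \<Longrightarrow> lam \<le> a * \<bar>a - 1\<bar> * y powr (a - 2)"
    and d: "d > 0" "lam * d\<^sup>2 \<ge> 2" "d \<ge> 2 * \<rho>"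
    and X: "finite X" "\<And>y. y \<in> X \<Longrightarrow> \<bar>y\<bar> < \<rho>'"
      "\<And>y. y \<in> X \<Longrightarrow> \<lfloor>\<bar>y\<bar> powr a + \<bar>M - y\<bar> powr a\<rfloor> = j"
  shows "\<exists>U. finite U \<and> card U \<le> 10 \<and> X \<subseteq> (\<Union>u\<in>U. {u..u + d})"
proof -
  define P where "P = (\<lambda>s s'. {y \<in> X. \<rho> < s * y \<and> 0 < s' * (M - y)})"
  have "\<exists>u v. P s s' \<subseteq> {u..u + d} \<union> {v..v + d}" if "s \<in> {-1, 1}" "s' \<in> {-1, 1}" for s s'
  proof (rule level_set_piece_cover[where M = M and j = j, OF a that \<open>\<rho> \<ge> 0\<close> lam d(1,2)])
    fix y assume "y \<in> P s s'"
    then have "y \<in> X" "\<rho> < s * y" "0 < s' * (M - y)" by (auto simp: P_def)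
    moreover have "s * y \<le> \<bar>y\<bar>" using that(1) by auto
    ultimately show "\<rho> < s * y \<and> s * y < \<rho>' \<and> 0 < s' * (M - y)" "\<lfloor>\<bar>y\<bar> powr a + \<bar>M - y\<bar> powr a\<rfloor> = j"
      using X(2)[of y] X(3)[of y] by auto
  qed (use X(1) in \<open>auto simp: P_def\<close>)
  then obtain u v where uv: "P s s' \<subseteq> {u s s'..u s s' + d} \<union> {v s s'..v s s' + d}"
    if "s \<in> {-1, 1}" "s' \<in> {-1, 1}" for s s' by metis
  define V where "V = [u 1 1, v 1 1, u 1 (-1), v 1 (-1), u (-1) 1, v (-1) 1, u (-1) (-1), v (-1) (-1), -\<rho>, M]"
  have "x \<in> (\<Union>u\<in>set V. {u..u + d})" if "x \<in> X" for x
  proof -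
    consider "\<bar>x\<bar> \<le> \<rho>" | "x = M" | "x \<in> P 1 1" | "x \<in> P 1 (-1)" | "x \<in> P (-1) 1" | "x \<in> P (-1) (-1)"
      using \<open>x \<in> X\<close> unfolding P_def mem_Collect_eq by (smt (verit))
    then show ?thesis
    proof cases
      case 1
      then have "x \<in> {-\<rho>..-\<rho> + d}" using d by auto
      then show ?thesis by (simp add: V_def)
    next
      case 2
      then have "x \<in> {M..M + d}" using d by auto
      then show ?thesis by (simp add: V_def)
    next
      case 3
      then have "x \<in> {u 1 1..u 1 1 + d} \<union> {v 1 1..v 1 1 + d}" using uv[of 1 1] by auto
      then show ?thesis unfolding V_def list.set UN_insert by blast
    next
      case 4
      then have "x \<in> {u 1 (-1)..u 1 (-1) + d} \<union> {v 1 (-1)..v 1 (-1) + d}" using uv[of 1 "-1"] by auto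
      then show ?thesis unfolding V_def list.set UN_insert by blast
    next
      case 5
      then have "x \<in> {u (-1) 1..u (-1) 1 + d} \<union> {v (-1) 1..v (-1) 1 + d}" using uv[of "-1" 1] by auto
      then show ?thesis unfolding V_def list.set UN_insert by blast
    next
      case 6
      then have "x \<in> {u (-1) (-1)..u (-1) (-1) + d} \<union> {v (-1) (-1)..v (-1) (-1) + d}" using uv[of "-1" "-1"] by auto
      then show ?thesis unfolding V_def list.set UN_insert by blast
    qed
  qed
  moreover have "card (set V) \<le> 10" using card_length[of V] by (simp add: V_def)
  ultimately show ?thesis by (intro exI[of _ "set V"]) auto
qed

text \<open>The length \<open>d\<close> must satisfy \<open>lam * d^2 \<ge> 2\<close> for a lower
  bound \<open>lam\<close> on the second derivative. For \<open>a \<ge> 2\<close> this bound is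
  uniform away from 0; for \<open>a < 2\<close> it decays like \<open>R powr (a - 2)\<close>, so
  \<open>d\<close> grows like \<open>R powr ((2 - a) / 2)\<close>, which is
  \<open>R powr (4 * sigma a)\<close>.\<close>

lemma level_set_cover_dyadic:
  fixes a W :: real
  assumes a: "a > 0" "a \<noteq> 1" and "W > 0"
  shows "\<exists>c>0. \<forall>R\<ge>1. \<forall>M j X. finite X \<longrightarrow>
      (\<forall>y\<in>X. \<bar>y\<bar> < W * R \<and> \<lfloor>\<bar>y\<bar> powr a + \<bar>M - y\<bar> powr a\<rfloor> = j) \<longrightarrow>
      (\<exists>U. finite U \<and> card U \<le> 10 \<and> X \<subseteq> (\<Union>u\<in>U. {u..u + c * R powr (4 * sigma a)}))"
proof (cases "a \<ge> 2")
  case True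
  \<comment> \<open>For \<open>y > 1\<close> the quantity
    \<open>a * \<bar>a - 1\<bar> * y powr (a - 2)\<close> is at least 2, so \<open>lam = 2\<close>
    and \<open>\<rho> = 1\<close> work with length 2; here \<open>sigma a = 0\<close>.\<close>
  show ?thesis
  proof (intro exI[of _ 2] conjI allI impI)
    fix R M :: real and j :: int and X :: "real set"
    assume *: "R \<ge> 1" "finite X"
      "\<forall>y\<in>X. \<bar>y\<bar> < W * R \<and> \<lfloor>\<bar>y\<bar> powr a + \<bar>M - y\<bar> powr a\<rfloor> = j"
    have "2 * 1 \<le> a * \<bar>a - 1\<bar>" using True by (intro mult_mono) auto
    moreover have "1 \<le> y powr (a - 2)" if "1 < y" for y using that True by (simp add: ge_one_powr_ge_zero)
    ultimately have "2 * 1 \<le> a * \<bar>a - 1\<bar> * y powr (a - 2)" if "1 < y" for y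
      using that a by (intro mult_mono[of 2 "a * \<bar>a - 1\<bar>" 1]) auto
    then have "\<exists>U. finite U \<and> card U \<le> 10 \<and> X \<subseteq> (\<Union>u\<in>U. {u..u + 2})"
      by (intro level_set_cover[where \<rho> = 1 and \<rho>' = "W * R" and lam = 2 and M = M and j = j, OF a]) (use * in auto)
    then show "\<exists>U. finite U \<and> card U \<le> 10 \<and> X \<subseteq> (\<Union>u\<in>U. {u..u + 2 * R powr (4 * sigma a)})"
      using \<open>R \<ge> 1\<close> True by (simp add: sigma_def)
  qed simp
next
  case False
  define b where "b = a * \<bar>a - 1\<bar>"
  have "b > 0" using a by (simp add: b_def)
  \<comment> \<open>Solved from \<open>b * (W * R) powr (a - 2) * d^2 = 2\<close> with
    \<open>d = c * R powr (4 * sigma a)\<close>: as \<open>a < 2\<close>, the curvature bound on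
    \<open>0 < y < W * R\<close> is smallest towards the far end.\<close>
  define c where "c = sqrt (2 / b) * W powr ((2 - a) / 2)"
  have "c > 0" using \<open>b > 0\<close> \<open>W > 0\<close> by (simp add: c_def)
  show ?thesis
  proof (intro exI[of _ c] conjI allI impI)
    show "c > 0" by fact
    fix R M :: real and j :: int and X :: "real set"
    assume *: "R \<ge> 1" "finite X"
      "\<forall>y\<in>X. \<bar>y\<bar> < W * R \<and> \<lfloor>\<bar>y\<bar> powr a + \<bar>M - y\<bar> powr a\<rfloor> = j"
    define d where "d = c * R powr (4 * sigma a)"
    have "W * R > 0" using \<open>W > 0\<close> \<open>R \<ge> 1\<close> by simp
    have d: "d = sqrt (2 / b) * (W * R) powr ((2 - a) / 2)"
    proof -
      have "4 * sigma a = (2 - a) / 2" using False by (simp add: sigma_def)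
      then show ?thesis using \<open>W > 0\<close> \<open>R \<ge> 1\<close> unfolding d_def c_def \<open>4 * sigma a = _\<close> by (simp add: powr_mult)
    qed
    have "d\<^sup>2 = 2 / b * (W * R) powr (2 - a)"
    proof -
      have "((W * R) powr ((2 - a) / 2))\<^sup>2 = (W * R) powr (2 - a)"
        using \<open>W * R > 0\<close> by (simp add: power2_eq_square flip: powr_add)
      then show ?thesis using \<open>b > 0\<close> by (simp add: d power_mult_distrib)
    qed
    moreover have "(W * R) powr (a - 2) * (W * R) powr (2 - a) = 1"
      using \<open>W > 0\<close> \<open>R \<ge> 1\<close> by (simp flip: powr_add)
    moreover have "b * u * (2 / b * v) = 2 * (u * v)" for u v using \<open>b > 0\<close> by simp
    ultimately have "b * (W * R) powr (a - 2) * d\<^sup>2 = 2" by (simp only: mult_1_right)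
    moreover have "b * (W * R) powr (a - 2) \<le> a * \<bar>a - 1\<bar> * y powr (a - 2)" if "0 < y" "y < W * R" for y
      using that False \<open>b > 0\<close> unfolding b_def[symmetric] by (intro mult_left_mono powr_mono2') auto
    moreover have "d > 0" using \<open>c > 0\<close> \<open>R \<ge> 1\<close> by (simp add: d_def)
    ultimately have "\<exists>U. finite U \<and> card U \<le> 10 \<and> X \<subseteq> (\<Union>u\<in>U. {u..u + d})"
      by (intro level_set_cover[where \<rho> = 0 and \<rho>' = "W * R" and lam = "b * (W * R) powr (a - 2)" and M = M and j = j, OF a]) (use * in auto)
    then show "\<exists>U. finite U \<and> card U \<le> 10 \<and> X \<subseteq> (\<Union>u\<in>U. {u..u + c * R powr (4 * sigma a)})"
      by (simp add: d_def)
  qed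
qed

section \<open>Lattice points in slabs\<close>

lemma card_int_le_diameter:
  fixes Z :: "int set"
  assumes "finite Z" "D \<ge> 0" "\<And>x y. x \<in> Z \<Longrightarrow> y \<in> Z \<Longrightarrow> real_of_int (x - y) \<le> D"
  shows "real (card Z) \<le> D + 1"
proof (cases "Z = {}")
  case False
  then have "Z \<subseteq> {Min Z..Min Z + \<lfloor>D\<rfloor>}"
  proof (intro subsetI)
    fix x assume "x \<in> Z"
    then have "x - Min Z \<le> \<lfloor>D\<rfloor>" using assms(3)[OF _ Min_in] assms(1) by (subst le_floor_iff) auto
    then show "x \<in> {Min Z..Min Z + \<lfloor>D\<rfloor>}" using \<open>x \<in> Z\<close> assms(1) by auto
  qed
  then have "card Z \<le> card {Min Z..Min Z + \<lfloor>D\<rfloor>}" by (intro card_mono) auto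
  moreover have "\<lfloor>D\<rfloor> \<ge> 0" using \<open>D \<ge> 0\<close> by simp
  ultimately have "int (card Z) \<le> \<lfloor>D\<rfloor> + 1" unfolding card_atLeastAtMost_int by linarith
  then show ?thesis by linarith
qed (use \<open>D \<ge> 0\<close> in simp)

lemma finite_int_abs_le: "finite {z::int. \<bar>real_of_int z\<bar> \<le> R}"
proof (rule finite_subset)
  show "{z. \<bar>real_of_int z\<bar> \<le> R} \<subseteq> {-\<lceil>R\<rceil>..\<lceil>R\<rceil>}"
  proof
    fix z assume "z \<in> {z. \<bar>real_of_int z\<bar> \<le> R}"
    then have "\<bar>real_of_int z\<bar> \<le> real_of_int \<lceil>R\<rceil>" using le_of_int_ceiling[of R] by (simp only: mem_Collect_eq order_trans)
    then have "\<bar>z\<bar> \<le> \<lceil>R\<rceil>" by (simp only: of_int_abs[symmetric] of_int_le_iff)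
    then show "z \<in> {-\<lceil>R\<rceil>..\<lceil>R\<rceil>}" unfolding atLeastAtMost_iff by linarith
  qed
qed simp

text \<open>All coordinates except the \<open>i\<close>-th range over at most \<open>3 * R\<close>
  integers each; once they are fixed, the slab confines the \<open>i\<close>-th to a set of diameter
  at most \<open>l / \<bar>\<omega> $ i\<bar>\<close>.\<close>

lemma card_lattice_slab:
  fixes \<omega> :: "real ^ 'n::finite" and u :: real
  assumes "\<omega> $ i \<noteq> 0" "R \<ge> 1" "l \<ge> 0"
  defines "A \<equiv> {k :: int ^ 'n. norm (rvec k) \<le> R \<and> rvec k \<bullet> \<omega> \<in> {u..u + l}}"
  shows "finite A" "real (card A) \<le> (3 * R) ^ (CARD('n) - 1) * (l / \<bar>\<omega> $ i\<bar> + 1)"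
proof -
  define Z where "Z = {z::int. \<bar>real_of_int z\<bar> \<le> R}"
  have finZ: "finite Z" unfolding Z_def by (rule finite_int_abs_le)
  have comp: "k $ j \<in> Z" if "k \<in> A" for k j
    using that component_le_norm_cart[of "rvec k" j] by (auto simp: A_def Z_def rvec_def)
  define P where "P = (UNIV - {i}) \<rightarrow>\<^sub>E Z"
  define fib where "fib = (\<lambda>r. {k \<in> A. restrict (($) k) (UNIV - {i}) = r})"
  have finP: "finite P" unfolding P_def using finZ by (intro finite_PiE) auto
  have inj: "inj_on (\<lambda>k. k $ i) (fib r)" for r
  proof (rule inj_onI)
    fix k l assume "k \<in> fib r" "l \<in> fib r" and eq: "k $ i = l $ i"
    then have "restrict (($) k) (UNIV - {i}) j = restrict (($) l) (UNIV - {i}) j" for j by (simp add: fib_def)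
    then have "k $ j = l $ j" if "j \<noteq> i" for j using that by (metis DiffI UNIV_I restrict_apply' singletonD)
    then show "k = l" using eq by (metis vec_eq_iff)
  qed
  have img: "(\<lambda>k. k $ i) ` fib r \<subseteq> Z" for r using comp by (auto simp: fib_def)
  have finfib: "finite (fib r)" for r
    using finite_subset[OF img finZ] inj finite_imageD by blast
  have sub: "A \<subseteq> (\<Union>r\<in>P. fib r)"
    using comp by (auto simp: P_def fib_def)
  then show "finite A" using finP finfib by (meson finite_UN finite_subset)
  have cardfib: "real (card (fib r)) \<le> l / \<bar>\<omega> $ i\<bar> + 1" for r
  proof -
    have "real (card ((\<lambda>k. k $ i) ` fib r)) \<le> l / \<bar>\<omega> $ i\<bar> + 1"
    proof (rule card_int_le_diameter)
      show "finite ((\<lambda>k. k $ i) ` fib r)" using finite_subset[OF img finZ] .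
      show "l / \<bar>\<omega> $ i\<bar> \<ge> 0" using \<open>l \<ge> 0\<close> by simp
      fix x y assume "x \<in> (\<lambda>k. k $ i) ` fib r" "y \<in> (\<lambda>k. k $ i) ` fib r"
      then obtain k k' where k: "x = k $ i" "y = k' $ i" "k \<in> fib r" "k' \<in> fib r" by auto
      then have "restrict (($) k) (UNIV - {i}) j = restrict (($) k') (UNIV - {i}) j" for j by (simp add: fib_def)
      then have eq: "k $ j = k' $ j" if "j \<noteq> i" for j using that by (metis DiffI UNIV_I restrict_apply' singletonD)
      \<comment> \<open>Two points of one fibre differ only in the \<open>i\<close>-th coordinate,
        so their frequencies differ by a multiple of \<open>\<omega> $ i\<close>.\<close>
      have "rvec k \<bullet> \<omega> - rvec k' \<bullet> \<omega> = (\<Sum>j\<in>UNIV. (real_of_int (k $ j) - real_of_int (k' $ j)) * \<omega> $ j)"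
        by (simp add: inner_vec_def rvec_def sum_subtractf left_diff_distrib)
      also have "\<dots> = (\<Sum>j\<in>UNIV. if j = i then real_of_int (x - y) * \<omega> $ i else 0)"
        by (intro sum.cong) (auto simp: eq k)
      finally have "real_of_int (x - y) * \<omega> $ i = rvec k \<bullet> \<omega> - rvec k' \<bullet> \<omega>" by simp
      moreover have "\<bar>rvec k \<bullet> \<omega> - rvec k' \<bullet> \<omega>\<bar> \<le> l" using k by (auto simp: fib_def A_def)
      ultimately have "\<bar>real_of_int (x - y)\<bar> * \<bar>\<omega> $ i\<bar> \<le> l" by (metis abs_mult)
      then have "\<bar>real_of_int (x - y)\<bar> \<le> l / \<bar>\<omega> $ i\<bar>" using assms(1) by (simp add: field_simps)
      then show "real_of_int (x - y) \<le> l / \<bar>\<omega> $ i\<bar>" by linarith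
    qed
    then show ?thesis using card_image[OF inj] by simp
  qed
  have "card A \<le> (\<Sum>r\<in>P. card (fib r))"
    using card_mono[OF _ sub] card_UN_le[OF finP, of fib] finP finfib by (meson finite_UN order_trans)
  then have "real (card A) \<le> (\<Sum>r\<in>P. real (card (fib r)))"
    by (metis of_nat_le_iff of_nat_sum)
  also have "\<dots> \<le> real (card P) * (l / \<bar>\<omega> $ i\<bar> + 1)"
    using cardfib by (intro sum_bounded_above)
  also have "real (card P) = real (card Z) ^ (CARD('n) - 1)"
    unfolding P_def by (subst card_PiE) (auto simp: card_Diff_singleton)
  also have "\<dots> \<le> (3 * R) ^ (CARD('n) - 1)"
  proof (rule power_mono)
    have "real (card Z) \<le> 2 * R + 1"
      using finZ \<open>R \<ge> 1\<close> by (intro card_int_le_diameter) (auto simp: Z_def)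
    then show "real (card Z) \<le> 3 * R" using \<open>R \<ge> 1\<close> by simp
  qed simp
  finally show "real (card A) \<le> (3 * R) ^ (CARD('n) - 1) * (l / \<bar>\<omega> $ i\<bar> + 1)"
    using \<open>l \<ge> 0\<close> by (simp add: mult_right_mono)
qed

section \<open>The quartic mean of a wave\<close>

text \<open>Levels are dyadic in \<open>1 + |k|^2\<close>, so level \<open>n\<close> means size
  about \<open>2 powr (n / 2)\<close>, and the Sobolev weight \<open>(1 + |k|^2) powr s\<close> is
  comparable with \<open>2 powr (s * n)\<close>. The origin gets level 0.\<close>

definition level :: "int ^ 'n::finite \<Rightarrow> nat" where
  "level k = nat \<lfloor>log 2 (1 + (norm (rvec k))\<^sup>2)\<rfloor>"

lemma level_bounds:
  "2 powr real (level k) \<le> 1 + (norm (rvec k))\<^sup>2" "1 + (norm (rvec k))\<^sup>2 < 2 powr (real (level k) + 1)"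
proof -
  define y where "y = 1 + (norm (rvec k))\<^sup>2"
  have "y \<ge> 1" by (simp add: y_def)
  then have "log 2 y \<ge> 0" by simp
  then have "real (level k) \<le> log 2 y" "log 2 y < real (level k) + 1"
    unfolding level_def y_def[symmetric] by linarith+
  then show "2 powr real (level k) \<le> 1 + (norm (rvec k))\<^sup>2" "1 + (norm (rvec k))\<^sup>2 < 2 powr (real (level k) + 1)"
    using \<open>y \<ge> 1\<close> unfolding y_def[symmetric] by (simp_all add: le_log_iff log_less_iff)
qed

text \<open>Otherwise the \<open>i\<close>-th unit vector would be a nontrivial rational
  relation.\<close>

lemma nonresonant_component_nonzero:
  assumes "nonresonant \<omega>"
  shows "\<omega> $ i \<noteq> 0"
proof
  assume "\<omega> $ i = 0"
  then have "(\<Sum>j\<in>UNIV. real_of_rat (if j = i then 1 else 0) * \<omega> $ j) = 0"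
    by (intro sum.neutral) auto
  then have "\<forall>j. (if j = i then 1 else 0 :: rat) = 0"
    by (rule assms[unfolded nonresonant_def, THEN spec, THEN mp])
  then show False by (metis one_neq_zero)
qed

text \<open>\<open>M\<close> stands for the frequency of a sum \<open>k + l\<close>, so
  \<open>M - rvec k \<bullet> \<omega>\<close> is that of the partner \<open>l\<close>. The
  frequencies lie in at most ten intervals by \<open>level_set_cover_dyadic\<close>, and
  \<open>card_lattice_slab\<close> counts the lattice points over each. The bound is
  \<open>R powr (4 * s)\<close> up to a constant, where \<open>R\<close> is the size of
  \<open>k\<close> at level \<open>n\<close>.\<close>

lemma level_count:
  fixes \<omega> :: "real ^ 'n::finite" and a s :: real
  assumes a: "a > 0" "a \<noteq> 1" and \<omega>: "nonresonant \<omega>" and s: "s = (real CARD('n) - 1) / 4 + sigma a"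
  obtains C where "C \<ge> 0"
    "\<And>n j M. finite {k. level k = n \<and> \<lfloor>\<bar>rvec k \<bullet> \<omega>\<bar> powr a + \<bar>M - rvec k \<bullet> \<omega>\<bar> powr a\<rfloor> = j}"
    "\<And>n j M. real (card {k. level k = n \<and> \<lfloor>\<bar>rvec k \<bullet> \<omega>\<bar> powr a + \<bar>M - rvec k \<bullet> \<omega>\<bar> powr a\<rfloor> = j})
       \<le> C * (2 powr (s / 2)) ^ (4 * n)"
proof -
  \<comment> \<open>Any coordinate serves, since nonresonance makes every component nonzero.\<close>
  define i :: 'n where "i = undefined"
  define w where "w = \<bar>\<omega> $ i\<bar>"
  have wi: "\<omega> $ i \<noteq> 0" using \<omega> by (rule nonresonant_component_nonzero)
  have "w > 0" using wi by (simp add: w_def)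
  \<comment> \<open>The added 1 makes the later frequency bound strict and the factor
    positive.\<close>
  have W: "norm \<omega> + 1 > 0" by (simp add: add_nonneg_pos)
  obtain c where "c > 0" and c: "\<forall>R\<ge>1. \<forall>M j X. finite X \<longrightarrow>
      (\<forall>y\<in>X. \<bar>y\<bar> < (norm \<omega> + 1) * R \<and> \<lfloor>\<bar>y\<bar> powr a + \<bar>M - y\<bar> powr a\<rfloor> = j) \<longrightarrow>
      (\<exists>U. finite U \<and> card U \<le> 10 \<and> X \<subseteq> (\<Union>u\<in>U. {u..u + c * R powr (4 * sigma a)}))"
    using level_set_cover_dyadic[OF a W] by blast
  \<comment> \<open>Ten intervals, the slab constant
    \<open>3 ^ (CARD('n) - 1) * (c / w + 1)\<close>, and \<open>2 powr (2 * s)\<close> for the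
    passage from \<open>R\<close> to \<open>2 powr (n / 2)\<close>.\<close>
  define C where "C = 10 * 3 ^ (CARD('n) - 1) * (c / w + 1) * 2 powr (2 * s)"
  have "C \<ge> 0" using \<open>c > 0\<close> \<open>w > 0\<close> by (simp add: C_def)
  have "finite {k. level k = n \<and> \<lfloor>\<bar>rvec k \<bullet> \<omega>\<bar> powr a + \<bar>M - rvec k \<bullet> \<omega>\<bar> powr a\<rfloor> = j}
      \<and> real (card {k. level k = n \<and> \<lfloor>\<bar>rvec k \<bullet> \<omega>\<bar> powr a + \<bar>M - rvec k \<bullet> \<omega>\<bar> powr a\<rfloor> = j})
       \<le> C * (2 powr (s / 2)) ^ (4 * n)" for n j M
  proof -
    define T where "T = {k. level k = n \<and> \<lfloor>\<bar>rvec k \<bullet> \<omega>\<bar> powr a + \<bar>M - rvec k \<bullet> \<omega>\<bar> powr a\<rfloor> = j}"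
    \<comment> \<open>The upper edge of level \<open>n\<close>:
      \<open>R^2 = 2 powr (n + 1)\<close>.\<close>
    define R :: real where "R = 2 powr ((real n + 1) / 2)"
    define A where "A = (\<lambda>l u. {k :: int ^ 'n. norm (rvec k) \<le> R \<and> rvec k \<bullet> \<omega> \<in> {u..u + l}})"
    have "R \<ge> 1" by (simp add: R_def ge_one_powr_ge_zero)
    have normR: "norm (rvec k) \<le> R" if "k \<in> T" for k
    proof (rule power2_le_imp_le)
      have "R\<^sup>2 = 2 powr (real n + 1)" by (simp add: R_def power2_eq_square flip: powr_add)
      then show "(norm (rvec k))\<^sup>2 \<le> R\<^sup>2" using level_bounds(2)[of k] that by (simp add: T_def)
    qed (use \<open>R \<ge> 1\<close> in simp)
    have inner: "\<bar>rvec k \<bullet> \<omega>\<bar> \<le> norm \<omega> * R" if "k \<in> T" for k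
      using Cauchy_Schwarz_ineq2[of "rvec k" \<omega>] mult_right_mono[OF normR[OF that], of "norm \<omega>"]
      by (simp add: mult.commute)
    \<comment> \<open>A crude slab around the whole range of frequencies, which serves to show that
      \<open>T\<close> is finite.\<close>
    have "T \<subseteq> A (2 * (norm \<omega> * R)) (- (norm \<omega> * R))"
    proof
      fix k assume "k \<in> T"
      then show "k \<in> A (2 * (norm \<omega> * R)) (- (norm \<omega> * R))"
        using normR[of k] inner[of k] unfolding A_def mem_Collect_eq atLeastAtMost_iff abs_le_iff by linarith
    qed
    moreover have "finite (A l u)" if "l \<ge> 0" for l u
      unfolding A_def by (rule card_lattice_slab(1)[OF wi \<open>R \<ge> 1\<close> that])
    ultimately have "finite T" using \<open>R \<ge> 1\<close> by (meson finite_subset mult_nonneg_nonneg norm_ge_zero order_trans zero_le_numeral zero_le_one)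
    define l where "l = c * R powr (4 * sigma a)"
    have "l \<ge> 0" using \<open>c > 0\<close> by (simp add: l_def)
    have "\<exists>U. finite U \<and> card U \<le> 10 \<and> (\<lambda>k. rvec k \<bullet> \<omega>) ` T \<subseteq> (\<Union>u\<in>U. {u..u + l})"
      unfolding l_def
    proof (rule c[rule_format, of _ _ M j])
      fix y assume "y \<in> (\<lambda>k. rvec k \<bullet> \<omega>) ` T"
      then obtain k where "k \<in> T" "y = rvec k \<bullet> \<omega>" by auto
      moreover have "norm \<omega> * R < (norm \<omega> + 1) * R" using \<open>R \<ge> 1\<close> by (simp add: distrib_right)
      ultimately show "\<bar>y\<bar> < (norm \<omega> + 1) * R \<and> \<lfloor>\<bar>y\<bar> powr a + \<bar>M - y\<bar> powr a\<rfloor> = j"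
        using inner[of k] by (simp add: T_def)
    qed (use \<open>R \<ge> 1\<close> \<open>finite T\<close> in auto)
    then obtain U where U: "finite U" "card U \<le> 10" "(\<lambda>k. rvec k \<bullet> \<omega>) ` T \<subseteq> (\<Union>u\<in>U. {u..u + l})" by auto
    have fin: "finite (A l u)" for u
      unfolding A_def by (rule card_lattice_slab(1)[OF wi \<open>R \<ge> 1\<close> \<open>l \<ge> 0\<close>])
    have "T \<subseteq> (\<Union>u\<in>U. A l u)" using U(3) normR by (force simp: A_def)
    then have "card T \<le> card (\<Union>u\<in>U. A l u)" using U(1) fin by (intro card_mono) auto
    also have "\<dots> \<le> (\<Sum>u\<in>U. card (A l u))" by (rule card_UN_le[OF U(1)])
    finally have "real (card T) \<le> (\<Sum>u\<in>U. real (card (A l u)))" by (metis of_nat_le_iff of_nat_sum)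
    also have "\<dots> \<le> real (card U) * ((3 * R) ^ (CARD('n) - 1) * (l / w + 1))"
      unfolding A_def w_def by (intro sum_bounded_above card_lattice_slab(2)[OF wi \<open>R \<ge> 1\<close> \<open>l \<ge> 0\<close>])
    \<comment> \<open>Since \<open>R powr (4 * sigma a) \<ge> 1\<close>, the summand 1 is absorbed
      into the interval length.\<close>
    also have "\<dots> \<le> 10 * ((3 * R) ^ (CARD('n) - 1) * ((c / w + 1) * R powr (4 * sigma a)))"
    proof (intro mult_mono mult_nonneg_nonneg)
      have "sigma a \<ge> 0" by (auto simp: sigma_def)
      then have "1 \<le> R powr (4 * sigma a)" using \<open>R \<ge> 1\<close> by (intro ge_one_powr_ge_zero) auto
      then show "l / w + 1 \<le> (c / w + 1) * R powr (4 * sigma a)"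
        by (simp add: l_def distrib_right)
    qed (use U(2) \<open>R \<ge> 1\<close> \<open>l \<ge> 0\<close> \<open>w > 0\<close> in auto)
    also have "\<dots> = 10 * 3 ^ (CARD('n) - 1) * (c / w + 1) * (R ^ (CARD('n) - 1) * R powr (4 * sigma a))"
      by (simp add: power_mult_distrib)
    \<comment> \<open>The value of \<open>s\<close> enters here:
      \<open>CARD('n) - 1 + 4 * sigma a = 4 * s\<close>.\<close>
    also have "R ^ (CARD('n) - 1) * R powr (4 * sigma a) = R powr (4 * s)"
    proof -
      have "real (CARD('n) - 1) = real CARD('n) - 1" by (simp add: of_nat_diff Suc_leI)
      then have "R ^ (CARD('n) - 1) = R powr (real CARD('n) - 1)"
        using \<open>R \<ge> 1\<close> by (metis less_le_trans powr_realpow zero_less_one)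
      moreover have "4 * ((N - 1) / 4 + t) = N - 1 + 4 * t" for N t :: real by (simp add: field_simps)
      ultimately show ?thesis unfolding s by (simp only: powr_add)
    qed
    also have "\<dots> = 2 powr (2 * s) * (2 powr (s / 2)) ^ (4 * n)"
    proof -
      have "(2 powr (s / 2)) ^ (4 * n) = 2 powr (s / 2 * real (4 * n))"
        by (subst powr_realpow[symmetric]) (simp_all add: powr_powr)
      moreover have "(real n + 1) / 2 * (4 * s) = 2 * s + s / 2 * real (4 * n)" by (simp add: field_simps)
      ultimately show ?thesis unfolding R_def powr_powr by (simp only: powr_add)
    qed
    finally show ?thesis using \<open>finite T\<close> by (simp add: C_def T_def mult_ac)
  qed
  then show thesis using that[OF \<open>C \<ge> 0\<close>] by blast
qed

section \<open>The fourth power mean in terms of coefficients\<close>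

definition wave :: "real ^ 'n::finite \<Rightarrow> real \<Rightarrow> (int ^ 'n \<Rightarrow> complex) \<Rightarrow> real \<Rightarrow> real \<Rightarrow> complex" where
  "wave \<omega> a c t x =
     (\<Sum>k | c k \<noteq> 0. c k * cis (2 * pi * ((rvec k \<bullet> \<omega>) * x + \<bar>rvec k \<bullet> \<omega>\<bar> powr a * t)))"

text \<open>Parseval's formula for the mean over \<open>x\<close> of the modulus squared of the square of \<^const>\<open>wave\<close>.\<close>
definition wave_mean4 :: "real ^ 'n::finite \<Rightarrow> real \<Rightarrow> (int ^ 'n \<Rightarrow> complex) \<Rightarrow> real \<Rightarrow> real" where
  "wave_mean4 \<omega> a c t =
     (let S = {k. c k \<noteq> 0} in \<Sum>m\<in>(\<lambda>p. fst p + snd p) ` (S \<times> S).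
       (norm (\<Sum>p | p \<in> S \<times> S \<and> fst p + snd p = m.
          c (fst p) * c (snd p)
            * cis (2 * pi * (\<bar>rvec (fst p) \<bullet> \<omega>\<bar> powr a + \<bar>rvec (snd p) \<bullet> \<omega>\<bar> powr a) * t)))\<^sup>2)"

lemma rvec_add: "rvec (k + l) = rvec k + rvec l"
  by (simp add: rvec_def vec_eq_iff)

text \<open>The fourth power of the modulus is the squared modulus of the square. Grouping the
  square by \<open>m = k + l\<close> gives a trigonometric polynomial whose frequencies are distinct
  by nonresonance, so \<open>mean_square_trig_tendsto\<close> applies.\<close>

lemma wave_mean4_tendsto:
  assumes \<omega>: "nonresonant \<omega>" and c: "finite {k. c k \<noteq> 0}"
  shows "((\<lambda>L. 1 / (2 * L) * integral {-L..L} (\<lambda>x. norm (wave \<omega> a c t x) ^ 4)) \<longlongrightarrow> wave_mean4 \<omega> a c t) at_top"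
proof -
  define S where "S = {k. c k \<noteq> 0}"
  define \<phi> where "\<phi> = (\<lambda>k. \<bar>rvec k \<bullet> \<omega>\<bar> powr a)"
  define I where "I = (\<lambda>p::(int^'a) \<times> (int^'a). fst p + snd p) ` (S \<times> S)"
  define b where "b = (\<lambda>m. \<Sum>p | p \<in> S \<times> S \<and> fst p + snd p = m. c (fst p) * c (snd p) * cis (2 * pi * (\<phi> (fst p) + \<phi> (snd p)) * t))"
  have "finite S" using c by (simp add: S_def)
  have \<phi>: "\<bar>rvec k \<bullet> \<omega>\<bar> powr a = \<phi> k" for k by (simp add: \<phi>_def)
  have rearr: "u * z1 * (v * z2) = u * v * z3 * z4" if "z1 * z2 = z3 * z4" for u v z1 z2 z3 z4 :: complex
  proof -
    have "u * z1 * (v * z2) = u * v * (z1 * z2)" by (simp only: mult_ac)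
    then show ?thesis by (simp only: that mult.assoc)
  qed
  have sq: "(wave \<omega> a c t x)\<^sup>2 = (\<Sum>m\<in>I. b m * cis (2 * pi * (rvec m \<bullet> \<omega>) * x))" for x
  proof -
    have "(wave \<omega> a c t x)\<^sup>2 = (\<Sum>p\<in>S \<times> S.
        c (fst p) * c (snd p) * cis (2 * pi * (\<phi> (fst p) + \<phi> (snd p)) * t) * cis (2 * pi * (rvec (fst p + snd p) \<bullet> \<omega>) * x))"
      unfolding power2_eq_square wave_def S_def[symmetric] sum_product sum.cartesian_product
    proof (intro sum.cong refl, clarify)
      fix k l
      have "cis (2 * pi * ((rvec k \<bullet> \<omega>) * x + \<phi> k * t)) * cis (2 * pi * ((rvec l \<bullet> \<omega>) * x + \<phi> l * t))
          = cis (2 * pi * (\<phi> k + \<phi> l) * t) * cis (2 * pi * (rvec (k + l) \<bullet> \<omega>) * x)"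
        by (simp add: cis_mult rvec_add inner_add_left algebra_simps)
      then show "c k * cis (2 * pi * (rvec k \<bullet> \<omega> * x + \<bar>rvec k \<bullet> \<omega>\<bar> powr a * t)) *
           (c l * cis (2 * pi * (rvec l \<bullet> \<omega> * x + \<bar>rvec l \<bullet> \<omega>\<bar> powr a * t))) =
           c (fst (k, l)) * c (snd (k, l)) * cis (2 * pi * (\<phi> (fst (k, l)) + \<phi> (snd (k, l))) * t) *
           cis (2 * pi * (rvec (fst (k, l) + snd (k, l)) \<bullet> \<omega>) * x)"
        unfolding \<phi> fst_conv snd_conv by (rule rearr)
    qed
    also have "\<dots> = (\<Sum>m\<in>I. \<Sum>p | p \<in> S \<times> S \<and> fst p + snd p = m.
        c (fst p) * c (snd p) * cis (2 * pi * (\<phi> (fst p) + \<phi> (snd p)) * t) * cis (2 * pi * (rvec (fst p + snd p) \<bullet> \<omega>) * x))"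
      unfolding I_def by (rule sum.image_gen) (use \<open>finite S\<close> in simp)
    also have "\<dots> = (\<Sum>m\<in>I. b m * cis (2 * pi * (rvec m \<bullet> \<omega>) * x))"
      unfolding b_def sum_distrib_right by (intro sum.cong refl) auto
    finally show ?thesis .
  qed
  have "norm (wave \<omega> a c t x) ^ 4 = (norm (\<Sum>m\<in>I. b m * cis (2 * pi * (rvec m \<bullet> \<omega>) * x)))\<^sup>2" for x
    unfolding sq[symmetric] by (simp add: norm_power flip: power_mult)
  moreover have "((\<lambda>L. 1 / (2 * L) * integral {-L..L} (\<lambda>x. (norm (\<Sum>m\<in>I. b m * cis (2 * pi * (rvec m \<bullet> \<omega>) * x)))\<^sup>2))
      \<longlongrightarrow> (\<Sum>m\<in>I. (norm (b m))\<^sup>2)) at_top"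
    by (rule mean_square_trig_tendsto)
       (use \<open>finite S\<close> inj_on_subset[OF nonresonant_inj[OF \<omega>]] in \<open>auto simp: I_def\<close>)
  moreover have "wave_mean4 \<omega> a c t = (\<Sum>m\<in>I. (norm (b m))\<^sup>2)"
    by (simp add: wave_mean4_def Let_def S_def I_def b_def \<phi>_def)
  ultimately show ?thesis by simp
qed

lemma continuous_on_wave_mean4: "continuous_on A (wave_mean4 \<omega> a c)"
  unfolding wave_mean4_def Let_def by (intro continuous_intros)

lemma wave_mean4_nonneg: "wave_mean4 \<omega> a c t \<ge> 0"
  unfolding wave_mean4_def Let_def by (intro sum_nonneg) auto

text \<open>The Sobolev norm on coefficients; the exponent is \<open>s / 2\<close> because
  \<open>L2_set\<close> squares its terms.\<close>

definition weighted_l2 :: "real \<Rightarrow> (int ^ 'n::finite \<Rightarrow> complex) \<Rightarrow> real" where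
  "weighted_l2 s c = L2_set (\<lambda>k. (1 + (norm (rvec k))\<^sup>2) powr (s / 2) * norm (c k)) {k. c k \<noteq> 0}"

text \<open>For each \<open>m\<close> the large sieve in \<open>t\<close> is applied to the pairs
  with \<open>k + l = m\<close>. The fibres it leaves have a prescribed sum and a prescribed integer
  part of the temporal frequency, and \<open>level_count\<close> supplies the counting hypothesis of
  \<open>dyadic_bilinear_bound\<close> for them.\<close>

lemma integral_wave_mean4_le:
  fixes \<omega> :: "real ^ 'n::finite" and a s :: real
  assumes card: "CARD('n) \<ge> 2" and \<omega>: "nonresonant \<omega>" and a: "a > 0" "a \<noteq> 1"
    and s: "s = (real CARD('n) - 1) / 4 + sigma a"
  obtains K where "K \<ge> 0"
    "\<And>c. finite {k. c k \<noteq> 0} \<Longrightarrow> integral {0..1} (wave_mean4 \<omega> a c) \<le> K * weighted_l2 s c ^ 4"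
proof -
  obtain C where "C \<ge> 0" and
    C: "\<And>n j M. finite {k. level k = n \<and> \<lfloor>\<bar>rvec k \<bullet> \<omega>\<bar> powr a + \<bar>M - rvec k \<bullet> \<omega>\<bar> powr a\<rfloor> = j}"
    "\<And>n j M. real (card {k. level k = n \<and> \<lfloor>\<bar>rvec k \<bullet> \<omega>\<bar> powr a + \<bar>M - rvec k \<bullet> \<omega>\<bar> powr a\<rfloor> = j})
       \<le> C * (2 powr (s / 2)) ^ (4 * n)"
    using level_count[OF a \<omega> s] by blast
  have "sigma a \<ge> 0" by (auto simp: sigma_def)
  moreover have "(real CARD('n) - 1) / 4 > 0" using card by simp
  \<comment> \<open>Positivity of \<open>s\<close> gives \<open>\<theta> > 1\<close> and thereby
    convergence of the geometric series in the constant.\<close>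
  ultimately have "s > 0" unfolding s by (simp only: add_pos_nonneg)
  \<comment> \<open>Chosen so that \<open>\<theta> ^ (2 * level k)\<close> is at most the Sobolev
    weight \<open>(1 + |k|^2) powr s\<close>.\<close>
  define \<theta> :: real where "\<theta> = 2 powr (s / 2)"
  have "\<theta> > 1" using \<open>s > 0\<close> by (simp add: \<theta>_def gr_one_powr)
  define Cs :: real where "Cs = 4 * (\<Sum>n. 9 / (real (Suc n))\<^sup>2)"
  have "Cs \<ge> 0"
    using suminf_nonneg[OF summable_divide_Suc_square[of 9]] by (simp add: Cs_def)
  define K where "K = Cs * (C * (2 * (\<Sum>n. (1 / \<theta>) ^ n))\<^sup>2)"
  show thesis
  proof (rule that)
    show "K \<ge> 0" using \<open>Cs \<ge> 0\<close> \<open>C \<ge> 0\<close> by (simp add: K_def)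
    fix c :: "int ^ 'n \<Rightarrow> complex" assume fin: "finite {k. c k \<noteq> 0}"
    define S where "S = {k. c k \<noteq> 0}"
    define h where "h = (\<lambda>p::(int^'n) \<times> (int^'n). \<bar>rvec (fst p) \<bullet> \<omega>\<bar> powr a + \<bar>rvec (snd p) \<bullet> \<omega>\<bar> powr a)"
    define P where "P = (\<lambda>m. {p. p \<in> S \<times> S \<and> fst p + snd p = m})"
    define I where "I = (\<lambda>p::(int^'n) \<times> (int^'n). fst p + snd p) ` (S \<times> S)"
    define g where "g = (\<lambda>p. (fst p + snd p, \<lfloor>h p\<rfloor>))"
    define F where "F = (\<lambda>p. norm (c (fst p)) * norm (c (snd p)))"
    have "finite S" using fin by (simp add: S_def)
    then have finP: "finite (P m)" "finite I" for m
      by (auto simp: P_def I_def intro: finite_subset[of _ "S \<times> S"])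
    have "wave_mean4 \<omega> a c = (\<lambda>t. \<Sum>m\<in>I. (norm (\<Sum>p\<in>P m. (c (fst p) * c (snd p)) * cis (2 * pi * h p * t)))\<^sup>2)"
      by (simp add: fun_eq_iff wave_mean4_def Let_def S_def I_def P_def h_def)
    then have "integral {0..1} (wave_mean4 \<omega> a c)
        = (\<Sum>m\<in>I. integral {0..1} (\<lambda>t. (norm (\<Sum>p\<in>P m. (c (fst p) * c (snd p)) * cis (2 * pi * h p * t)))\<^sup>2))"
      by (simp only:) (intro integral_sum finP integrable_continuous_interval continuous_intros)
    also have "\<dots> \<le> (\<Sum>m\<in>I. Cs * (\<Sum>j\<in>(\<lambda>p. \<lfloor>h p\<rfloor>) ` P m. (\<Sum>p | p \<in> P m \<and> \<lfloor>h p\<rfloor> = j. norm (c (fst p) * c (snd p)))\<^sup>2))"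
      unfolding Cs_def by (intro sum_mono large_sieve_unit_interval finP)
    also have "\<dots> = Cs * (\<Sum>m\<in>I. \<Sum>j\<in>(\<lambda>p. \<lfloor>h p\<rfloor>) ` P m. (\<Sum>p | p \<in> S \<times> S \<and> g p = (m, j). F p)\<^sup>2)"
    proof -
      have "{p. p \<in> P m \<and> \<lfloor>h p\<rfloor> = j} = {p. p \<in> S \<times> S \<and> g p = (m, j)}" for m j
        by (auto simp: P_def g_def)
      then show ?thesis by (simp add: sum_distrib_left norm_mult F_def)
    qed
    also have "(\<Sum>m\<in>I. \<Sum>j\<in>(\<lambda>p. \<lfloor>h p\<rfloor>) ` P m. (\<Sum>p | p \<in> S \<times> S \<and> g p = (m, j). F p)\<^sup>2)
        = (\<Sum>(m, j)\<in>Sigma I (\<lambda>m. (\<lambda>p. \<lfloor>h p\<rfloor>) ` P m). (\<Sum>p | p \<in> S \<times> S \<and> g p = (m, j). F p)\<^sup>2)"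
      by (rule sum.Sigma) (use finP in auto)
    also have "\<dots> = (\<Sum>i\<in>g ` (S \<times> S). (\<Sum>p | p \<in> S \<times> S \<and> g p = i. F p)\<^sup>2)"
    proof (rule sum.cong)
      \<comment> \<open>For each \<open>m\<close> only integer parts that occur for a pair with sum
        \<open>m\<close> are listed, so the dependent index set is exactly the image of
        \<open>g\<close>.\<close>
      show "Sigma I (\<lambda>m. (\<lambda>p. \<lfloor>h p\<rfloor>) ` P m) = g ` (S \<times> S)"
        by (force simp: I_def P_def g_def image_iff)
    qed auto
    also have "\<dots> \<le> C * (2 * (\<Sum>n. (1 / \<theta>) ^ n))\<^sup>2 * (\<Sum>k\<in>S. \<theta> ^ (2 * level k) * (norm (c k))\<^sup>2)\<^sup>2"
      unfolding F_def
    proof (rule dyadic_bilinear_bound[OF \<open>finite S\<close> \<open>\<theta> > 1\<close> \<open>C \<ge> 0\<close>])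
      fix i :: "(int ^ 'n) \<times> int" and n1 n2 :: nat
      obtain m j where i: "i = (m, j)" by fastforce
      define E where "E = {p \<in> S \<times> S. g p = i \<and> level (fst p) = n1 \<and> level (snd p) = n2}"
      define Q where "Q = (\<lambda>n. {k. level k = n \<and> \<lfloor>\<bar>rvec k \<bullet> \<omega>\<bar> powr a + \<bar>rvec m \<bullet> \<omega> - rvec k \<bullet> \<omega>\<bar> powr a\<rfloor> = j})"
      have E: "fst p + snd p = m" "\<lfloor>h p\<rfloor> = j" "level (fst p) = n1" "level (snd p) = n2" if "p \<in> E" for p
        using that by (auto simp: E_def g_def i)
      have freq: "rvec m \<bullet> \<omega> - rvec (fst p) \<bullet> \<omega> = rvec (snd p) \<bullet> \<omega>" "rvec m \<bullet> \<omega> - rvec (snd p) \<bullet> \<omega> = rvec (fst p) \<bullet> \<omega>"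
        if "p \<in> E" for p
        using E(1)[OF that] by (auto simp: rvec_add inner_add_left)
      \<comment> \<open>Given the sum \<open>m\<close>, either member of a pair determines the
        other. Counting by the member of smaller level yields \<open>min n1 n2\<close>.\<close>
      have inj: "inj_on fst E" "inj_on snd E"
        using E(1) by (auto intro!: inj_onI intro: prod_eqI) (metis E(1) add_left_cancel add_right_cancel fst_conv snd_conv)+
      have "card E \<le> card (Q n1)"
        by (rule card_inj_on_le[OF inj(1)]) (use C(1) E freq in \<open>auto simp: Q_def h_def\<close>)
      moreover have "card E \<le> card (Q n2)"
        by (rule card_inj_on_le[OF inj(2)]) (use C(1) E freq in \<open>auto simp: Q_def h_def add.commute\<close>)
      ultimately have "card E \<le> card (Q (min n1 n2))" by (simp add: min_def)
      then show "real (card E) \<le> C * \<theta> ^ (4 * min n1 n2)"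
        unfolding Q_def \<theta>_def using C(2) by (meson of_nat_mono order_trans)
    qed
    also have "\<dots> \<le> C * (2 * (\<Sum>n. (1 / \<theta>) ^ n))\<^sup>2 * ((weighted_l2 s c)\<^sup>2)\<^sup>2"
    proof (intro mult_left_mono power_mono)
      have "(weighted_l2 s c)\<^sup>2 = (\<Sum>k\<in>S. (1 + (norm (rvec k))\<^sup>2) powr s * (norm (c k))\<^sup>2)"
        unfolding weighted_l2_def L2_set_def S_def
        by (simp add: sum_nonneg power_mult_distrib) (simp add: power2_eq_square flip: powr_add)
      moreover have "\<theta> ^ (2 * level k) \<le> (1 + (norm (rvec k))\<^sup>2) powr s" for k :: "int ^ 'n"
      proof -
        have "\<theta> ^ (2 * level k) = (2 powr real (level k)) powr s"
          unfolding \<theta>_def by (subst powr_realpow[symmetric]) (simp_all add: powr_powr mult_ac)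
        also have "\<dots> \<le> (1 + (norm (rvec k))\<^sup>2) powr s"
          using level_bounds(1)[of k] \<open>s > 0\<close> by (intro powr_mono2) auto
        finally show ?thesis .
      qed
      ultimately show "(\<Sum>k\<in>S. \<theta> ^ (2 * level k) * (norm (c k))\<^sup>2) \<le> (weighted_l2 s c)\<^sup>2"
        by (auto intro!: sum_mono mult_right_mono)
    qed (use \<open>\<theta> > 1\<close> \<open>C \<ge> 0\<close> in \<open>auto intro!: sum_nonneg\<close>)
    finally show "integral {0..1} (wave_mean4 \<omega> a c) \<le> K * weighted_l2 s c ^ 4"
      using \<open>Cs \<ge> 0\<close> by (simp add: K_def mult.assoc mult_left_mono flip: power_mult)
  qed
qed

section \<open>Extension to the completion\<close>

text \<open>The zero of the ambient type need not be available, so the two forms of the triangle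
  inequality are listed separately.\<close>
definition difference_norm :: "'v::minus set \<Rightarrow> ('v \<Rightarrow> ennreal) \<Rightarrow> bool" where
  "difference_norm V N \<longleftrightarrow>
     (\<forall>x\<in>V. N x < \<infinity> \<and> N (x - x) = 0) \<and>
     (\<forall>x\<in>V. \<forall>y\<in>V. x - y \<in> V \<and> N (x - y) = N (y - x) \<and> N x \<le> N y + N (x - y)) \<and>
     (\<forall>x\<in>V. \<forall>y\<in>V. \<forall>z\<in>V. N (x - z) \<le> N (x - y) + N (y - z))"

lemma null_rel_equiv:
  assumes "difference_norm V N"
  shows "equiv (cauchy_seqs V N) (null_rel V N)"
proof (rule equivI)
  show "null_rel V N \<subseteq> cauchy_seqs V N \<times> cauchy_seqs V N" by (auto simp: null_rel_def)
  show "refl_on (cauchy_seqs V N) (null_rel V N)"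
    using assms by (auto simp: refl_on_def null_rel_def difference_norm_def cauchy_seqs_def)
  show "sym (null_rel V N)"
  proof (rule symI)
    fix X Y assume *: "(X, Y) \<in> null_rel V N"
    then have "X n \<in> V" "Y n \<in> V" for n by (auto simp: null_rel_def cauchy_seqs_def)
    then have "N (X n - Y n) = N (Y n - X n)" for n using assms by (simp add: difference_norm_def)
    then show "(Y, X) \<in> null_rel V N" using * by (simp add: null_rel_def)
  qed
  show "trans (null_rel V N)"
  proof (rule transI)
    fix X Y Z assume *: "(X, Y) \<in> null_rel V N" "(Y, Z) \<in> null_rel V N"
    then have V: "X n \<in> V" "Y n \<in> V" "Z n \<in> V" for n by (auto simp: null_rel_def cauchy_seqs_def)
    have "(\<lambda>n. N (X n - Z n)) \<longlonglongrightarrow> 0"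
    proof (rule tendsto_sandwich[OF _ _ tendsto_const])
      have "(\<lambda>n. N (X n - Y n) + N (Y n - Z n)) \<longlonglongrightarrow> 0 + 0"
        using * by (intro tendsto_add) (auto simp: null_rel_def)
      then show "(\<lambda>n. N (X n - Y n) + N (Y n - Z n)) \<longlonglongrightarrow> 0" by simp
    qed (use V assms in \<open>auto simp: difference_norm_def\<close>)
    then show "(X, Z) \<in> null_rel V N" using * by (simp add: null_rel_def)
  qed
qed

text \<open>By the triangle inequality the norms of a Cauchy sequence form a Cauchy sequence of
  reals; finiteness of \<open>N\<close> on \<open>V\<close> allows the passage from
  \<open>ennreal\<close>.\<close>

lemma cauchy_seqs_norm_converges:
  assumes N: "difference_norm V N" and X: "X \<in> cauchy_seqs V N"
  shows "\<exists>l. (\<lambda>n. N (X n)) \<longlonglongrightarrow> l \<and> l < \<infinity>"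
proof -
  have V: "X n \<in> V" for n using X by (simp add: cauchy_seqs_def)
  have fin: "N (X n) < \<infinity>" "N (X m - X n) < \<infinity>" for m n
    using N V by (auto simp: difference_norm_def)
  define r where "r = (\<lambda>n. enn2real (N (X n)))"
  have r: "N (X n) = ennreal (r n)" for n using fin(1)[of n] by (simp add: r_def)
  have r0: "r n \<ge> 0" for n by (simp add: r_def)
  have le: "r m \<le> r n + enn2real (N (X m - X n))" for m n
  proof -
    have "N (X m) \<le> N (X n) + N (X m - X n)" using N V by (auto simp: difference_norm_def)
    also have "N (X m - X n) = ennreal (enn2real (N (X m - X n)))" using fin by simp
    finally show ?thesis using r0 by (simp add: r flip: ennreal_plus)
  qed
  have "Cauchy r"
  proof (rule metric_CauchyI)
    fix e :: real assume "e > 0"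
    then obtain M where M: "\<And>m n. m \<ge> M \<Longrightarrow> n \<ge> M \<Longrightarrow> N (X m - X n) < ennreal e"
      using X unfolding cauchy_seqs_def by (auto, metis ennreal_less_zero_iff)
    have "dist (r m) (r n) < e" if "m \<ge> M" "n \<ge> M" for m n
    proof -
      have "enn2real (N (X i - X j)) < e" if "i \<ge> M" "j \<ge> M" for i j
        using M[OF that] \<open>e > 0\<close> fin by (simp add: enn2real_less_iff)
      then show ?thesis using le[of m n] le[of n m] that by (smt (verit) dist_real_def)
    qed
    then show "\<exists>M. \<forall>m\<ge>M. \<forall>n\<ge>M. dist (r m) (r n) < e" by blast
  qed
  then obtain l where "r \<longlonglongrightarrow> l" using real_Cauchy_convergent convergent_def by blast
  then have "(\<lambda>n. N (X n)) \<longlonglongrightarrow> ennreal l" unfolding r by (intro tendsto_ennrealI)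
  then show ?thesis by (intro exI[of _ "ennreal l"]) simp
qed

text \<open>Each norm exceeds the other by at most \<open>N (X n - Y n)\<close>, which tends to 0.
  The norms of \<open>Y\<close> are already known to converge, so the two limits can be compared in
  both directions.\<close>

lemma null_rel_same_limit:
  assumes N: "difference_norm V N" and XY: "(X, Y) \<in> null_rel V N" and l: "(\<lambda>n. N (X n)) \<longlonglongrightarrow> l"
  shows "(\<lambda>n. N (Y n)) \<longlonglongrightarrow> l"
proof -
  have V: "X n \<in> V" "Y n \<in> V" for n using XY by (auto simp: null_rel_def cauchy_seqs_def)
  have Y: "Y \<in> cauchy_seqs V N" and d: "(\<lambda>n. N (X n - Y n)) \<longlonglongrightarrow> 0" using XY by (auto simp: null_rel_def)
  obtain k where k: "(\<lambda>n. N (Y n)) \<longlonglongrightarrow> k" using cauchy_seqs_norm_converges[OF N Y] by blast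
  have "l \<le> k + 0"
    by (rule LIMSEQ_le[OF l tendsto_add[OF k d]]) (use N V in \<open>auto simp: difference_norm_def\<close>)
  moreover have "k \<le> l + 0"
  proof (rule LIMSEQ_le[OF k tendsto_add[OF l d]])
    have "N (Y n) \<le> N (X n) + N (X n - Y n)" for n
      using N V unfolding difference_norm_def by metis
    then show "\<exists>M. \<forall>n\<ge>M. N (Y n) \<le> N (X n) + N (X n - Y n)" by blast
  qed
  ultimately show ?thesis using k by simp
qed

text \<open>Equivalent sequences share the limit of their norms, so the image in the definition is a
  singleton and \<open>the_elem\<close> is determined.\<close>

lemma completion_norm_class:
  assumes N: "difference_norm V N" and X: "X \<in> cauchy_seqs V N" and l: "(\<lambda>n. N (X n)) \<longlonglongrightarrow> l"
  shows "completion_norm N (null_rel V N `` {X}) = l"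
proof -
  have "(\<lambda>Y. lim (\<lambda>n. N (Y n))) ` (null_rel V N `` {X}) = {l}"
  proof -
    have "lim (\<lambda>n. N (Y n)) = l" if "(X, Y) \<in> null_rel V N" for Y
      using null_rel_same_limit[OF N that l] by (rule limI)
    moreover have "(X, X) \<in> null_rel V N"
      using null_rel_equiv[OF N] X by (simp add: equiv_def refl_on_def)
    ultimately show ?thesis by force
  qed
  then show ?thesis by (simp add: completion_norm_def)
qed

text \<open>The bound on differences carries Cauchy sequences to Cauchy sequences and null pairs to
  null pairs, so the image class is independent of the representative, and the inequality passes to
  the limit.\<close>

lemma completion_extension:
  assumes N: "difference_norm V N" and M: "difference_norm (T ` V) M"
    and T: "\<And>x y. x \<in> V \<Longrightarrow> y \<in> V \<Longrightarrow> T (x - y) = T x - T y"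
    and bound: "\<And>x. x \<in> V \<Longrightarrow> M (T x) \<le> ennreal K * N x"
    and \<xi>: "\<xi> \<in> completion V N"
  shows "completion_map T (T ` V) M \<xi> \<in> completion (T ` V) M"
    and "completion_norm M (completion_map T (T ` V) M \<xi>) \<le> ennreal K * completion_norm N \<xi>"
proof -
  obtain X where X: "X \<in> cauchy_seqs V N" and \<xi>X: "\<xi> = null_rel V N `` {X}"
    using \<xi> unfolding completion_def by (auto elim: quotientE)
  have diff: "M (T x - T y) \<le> ennreal K * N (x - y)" if "x \<in> V" "y \<in> V" for x y
    using bound[of "x - y"] T[OF that] N that by (simp add: difference_norm_def)
  have TC: "(\<lambda>n. T (Y n)) \<in> cauchy_seqs (T ` V) M" if Y: "Y \<in> cauchy_seqs V N" for Y
  proof -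
    have V: "Y n \<in> V" for n using Y by (simp add: cauchy_seqs_def)
    have "\<exists>m0. \<forall>m\<ge>m0. \<forall>n\<ge>m0. M (T (Y m) - T (Y n)) < e" if "e > 0" for e
    proof -
      \<comment> \<open>A \<open>d > 0\<close> with \<open>ennreal K * d < e\<close> is found along
        \<open>1 / (n + 1)\<close>, which also covers \<open>ennreal K = 0\<close> and infinite
        \<open>e\<close>.\<close>
      have "(\<lambda>n. ennreal K * ennreal (inverse (real (Suc n)))) \<longlonglongrightarrow> ennreal K * ennreal 0"
        by (intro ennreal_tendsto_cmult tendsto_ennrealI LIMSEQ_inverse_real_of_nat) simp
      then have "\<forall>\<^sub>F n in sequentially. ennreal K * ennreal (inverse (real (Suc n))) < e"
        using that by (intro order_tendstoD) auto
      then obtain n where "ennreal K * ennreal (inverse (real (Suc n))) < e"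
        by (auto dest: eventually_happens'[OF sequentially_bot])
      moreover have "ennreal (inverse (real (Suc n))) > 0" by simp
      ultimately obtain d where "d > 0" "ennreal K * d < e" by blast
      then obtain m0 where "\<And>m n. m \<ge> m0 \<Longrightarrow> n \<ge> m0 \<Longrightarrow> N (Y m - Y n) < d"
        using Y unfolding cauchy_seqs_def by blast
      then have "M (T (Y m) - T (Y n)) < e" if "m \<ge> m0" "n \<ge> m0" for m n
        using diff[OF V V, of m n] that \<open>ennreal K * d < e\<close>
        by (meson le_less_trans less_imp_le mult_left_mono zero_le)
      then show ?thesis by blast
    qed
    then show ?thesis using V by (auto simp: cauchy_seqs_def)
  qed
  have rel: "((\<lambda>n. T (X n)), (\<lambda>n. T (Y n))) \<in> null_rel (T ` V) M" if XY: "(X, Y) \<in> null_rel V N" for Y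
  proof -
    have V: "X n \<in> V" "Y n \<in> V" for n using XY by (auto simp: null_rel_def cauchy_seqs_def)
    have "(\<lambda>n. M (T (X n) - T (Y n))) \<longlonglongrightarrow> 0"
    proof (rule tendsto_sandwich[OF _ _ tendsto_const])
      have "(\<lambda>n. ennreal K * N (X n - Y n)) \<longlonglongrightarrow> ennreal K * 0"
        using XY by (intro ennreal_tendsto_cmult) (auto simp: null_rel_def)
      then show "(\<lambda>n. ennreal K * N (X n - Y n)) \<longlonglongrightarrow> 0" by simp
    qed (use diff V in auto)
    then show ?thesis using XY TC by (auto simp: null_rel_def)
  qed
  have eqM: "equiv (cauchy_seqs (T ` V) M) (null_rel (T ` V) M)" by (rule null_rel_equiv[OF M])
  have XX: "(X, X) \<in> null_rel V N"
    using null_rel_equiv[OF N] X by (simp add: equiv_def refl_on_def)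
  \<comment> \<open>All representatives give the same class, so the union in
    \<open>completion_map\<close> collapses to one class.\<close>
  have map: "completion_map T (T ` V) M \<xi> = null_rel (T ` V) M `` {\<lambda>n. T (X n)}"
  proof -
    have "null_rel (T ` V) M `` {\<lambda>n. T (Y n)} = null_rel (T ` V) M `` {\<lambda>n. T (X n)}" if "Y \<in> \<xi>" for Y
      using equiv_class_eq[OF eqM rel[of Y]] that by (simp add: \<xi>X)
    moreover have "X \<in> \<xi>" using XX by (simp add: \<xi>X)
    ultimately show ?thesis unfolding completion_map_def by blast
  qed
  show "completion_map T (T ` V) M \<xi> \<in> completion (T ` V) M"
    unfolding map completion_def by (rule quotientI[OF TC[OF X]])
  obtain l where l: "(\<lambda>n. N (X n)) \<longlonglongrightarrow> l" using cauchy_seqs_norm_converges[OF N X] by blast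
  obtain k where k: "(\<lambda>n. M (T (X n))) \<longlonglongrightarrow> k" using cauchy_seqs_norm_converges[OF M TC[OF X]] by blast
  have "k \<le> ennreal K * l"
    using X by (intro LIMSEQ_le[OF k ennreal_tendsto_cmult[OF _ l]]) (auto simp: bound cauchy_seqs_def)
  then show "completion_norm M (completion_map T (T ` V) M \<xi>) \<le> ennreal K * completion_norm N \<xi>"
    unfolding map unfolding \<xi>X completion_norm_class[OF N X l] completion_norm_class[OF M TC[OF X] k] .
qed

section \<open>The estimate\<close>

abbreviation finite_support :: "('k \<Rightarrow> complex) set" where
  "finite_support \<equiv> {c. finite {k. c k \<noteq> 0}}"

lemma finite_support_add: "c \<in> finite_support \<Longrightarrow> d \<in> finite_support \<Longrightarrow> (\<lambda>k. c k + d k) \<in> finite_support"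
  by (simp, rule finite_subset[of _ "{k. c k \<noteq> 0} \<union> {k. d k \<noteq> 0}"]) auto

lemma finite_support_diff: "c \<in> finite_support \<Longrightarrow> d \<in> finite_support \<Longrightarrow> c - d \<in> finite_support"
  by (simp, rule finite_subset[of _ "{k. c k \<noteq> 0} \<union> {k. d k \<noteq> 0}"]) auto

lemma wave_superset:
  assumes "finite S" "{k. c k \<noteq> 0} \<subseteq> S"
  shows "wave \<omega> a c t x = (\<Sum>k\<in>S. c k * cis (2 * pi * ((rvec k \<bullet> \<omega>) * x + \<bar>rvec k \<bullet> \<omega>\<bar> powr a * t)))"
  unfolding wave_def using assms by (intro sum.mono_neutral_left) auto

lemma wave_add:
  assumes "c \<in> finite_support" "d \<in> finite_support"
  shows "wave \<omega> a (\<lambda>k. c k + d k) t x = wave \<omega> a c t x + wave \<omega> a d t x"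
proof -
  define S where "S = {k. c k \<noteq> 0} \<union> {k. d k \<noteq> 0}"
  have S: "finite S" "{k. c k \<noteq> 0} \<subseteq> S" "{k. d k \<noteq> 0} \<subseteq> S" "{k. c k + d k \<noteq> 0} \<subseteq> S"
    using assms by (auto simp: S_def)
  show ?thesis
    unfolding wave_superset[OF S(1,2)] wave_superset[OF S(1,3)] wave_superset[of S "\<lambda>k. c k + d k", OF S(1,4)]
    by (simp add: distrib_right sum.distrib)
qed

lemma wave_diff:
  assumes "c \<in> finite_support" "d \<in> finite_support"
  shows "wave \<omega> a (c - d) = wave \<omega> a c - wave \<omega> a d"
proof -
  have "wave \<omega> a c t x = wave \<omega> a d t x + wave \<omega> a (c - d) t x" for t x
    using wave_add[OF assms(2) finite_support_diff[OF assms], of \<omega> a t x] by simp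
  then show ?thesis by (simp add: fun_eq_iff)
qed

lemma trig_sum_diff:
  assumes "c \<in> finite_support" "d \<in> finite_support"
  shows "trig_sum \<omega> (c - d) = trig_sum \<omega> c - trig_sum \<omega> d"
proof -
  define S where "S = {k. c k \<noteq> 0} \<union> {k. d k \<noteq> 0}"
  have S: "finite S" "{k. c k \<noteq> 0} \<subseteq> S" "{k. d k \<noteq> 0} \<subseteq> S" "{k. (c - d) k \<noteq> 0} \<subseteq> S"
    using assms by (auto simp: S_def)
  show ?thesis
    by (simp add: fun_eq_iff trig_sum_superset[OF S(1,2)] trig_sum_superset[OF S(1,3)]
        trig_sum_superset[OF S(1,4)] left_diff_distrib sum_subtractf)
qed

text \<open>Uniqueness of the coefficients under nonresonance eliminates the definite description in
  \<open>fourier_coeff\<close> and leaves an explicit sum.\<close>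

lemma propagator_trig_sum:
  assumes "nonresonant \<omega>" "c \<in> finite_support"
  shows "propagator \<omega> a (trig_sum \<omega> c) = wave \<omega> a c"
  using assms by (simp add: fun_eq_iff propagator_def wave_def fourier_coeff_trig_sum)

lemma sobolev_norm_trig_sum:
  assumes "nonresonant \<omega>" "c \<in> finite_support"
  shows "sobolev_norm \<omega> s (trig_sum \<omega> c) = ennreal (weighted_l2 s c)"
proof -
  have "((1 + r\<^sup>2) powr (s / 2))\<^sup>2 = (1 + r\<^sup>2) powr s" for r :: real
    by (simp add: power2_eq_square flip: powr_add)
  then show ?thesis
    using assms by (simp add: sobolev_norm_def fourier_coeff_trig_sum weighted_l2_def L2_set_def power_mult_distrib)
qed

section \<open>From \<open>ennreal\<close> norms to real integrals\<close>

lemma set_nn_integral_continuous: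
  fixes g :: "real \<Rightarrow> real"
  assumes "continuous_on UNIV g" "\<And>x. g x \<ge> 0"
  shows "(\<integral>\<^sup>+x\<in>{a..b}. ennreal (g x) \<partial>lborel) = ennreal (integral {a..b} g)"
  by (intro nn_integral_has_integral_lebesgue' integrable_integral integrable_continuous_interval assms
      continuous_on_subset[OF assms(1)] subset_UNIV)

lemma continuous_on_wave: "continuous_on A (wave \<omega> a c t)"
  unfolding wave_def by (intro continuous_intros)

text \<open>The averages converge, so their \<open>Limsup\<close> is the limit found in
  \<open>wave_mean4_tendsto\<close>.\<close>

lemma mean_norm_pow_wave:
  assumes "nonresonant \<omega>" "c \<in> finite_support"
  shows "mean_norm_pow 4 (wave \<omega> a c t) = ennreal (wave_mean4 \<omega> a c t)"
  unfolding mean_norm_pow_def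
proof (rule lim_imp_Limsup)
  have pow4: "ennreal (norm z powr 4) = ennreal (norm z ^ 4)" for z :: complex
    by (cases "z = 0") (simp_all add: powr_numeral)
  have "((\<lambda>L. ennreal (1 / (2 * L) * integral {-L..L} (\<lambda>x. norm (wave \<omega> a c t x) ^ 4)))
      \<longlongrightarrow> ennreal (wave_mean4 \<omega> a c t)) at_top"
    using assms by (intro tendsto_ennrealI wave_mean4_tendsto) auto
  moreover have "\<forall>\<^sub>F L in at_top. ennreal (1 / (2 * L) * integral {-L..L} (\<lambda>x. norm (wave \<omega> a c t x) ^ 4))
      = ennreal (1 / (2 * L)) * (\<integral>\<^sup>+x\<in>{-L..L}. ennreal (norm (wave \<omega> a c t x) powr 4) \<partial>lborel)"
    using eventually_gt_at_top[of 0]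
  proof eventually_elim
    case (elim L)
    have "(\<integral>\<^sup>+x\<in>{-L..L}. ennreal (norm (wave \<omega> a c t x) powr 4) \<partial>lborel)
        = ennreal (integral {-L..L} (\<lambda>x. norm (wave \<omega> a c t x) ^ 4))"
      unfolding pow4 by (rule set_nn_integral_continuous) (auto intro!: continuous_intros continuous_on_wave)
    then show ?case using elim by (simp only:) (rule ennreal_mult', simp)
  qed
  ultimately show "((\<lambda>L. ennreal (1 / (2 * L)) * (\<integral>\<^sup>+x\<in>{-L..L}. ennreal (norm (wave \<omega> a c t x) powr 4) \<partial>lborel))
      \<longlongrightarrow> ennreal (wave_mean4 \<omega> a c t)) at_top"
    by (rule Lim_transform_eventually)
qed simp

section \<open>The space-time norm as a function of the coefficients\<close>

definition wave_norm4 :: "real ^ 'n::finite \<Rightarrow> real \<Rightarrow> (int ^ 'n \<Rightarrow> complex) \<Rightarrow> real" where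
  "wave_norm4 \<omega> a c = integral {0..1} (wave_mean4 \<omega> a c) powr (1 / 4)"

lemma integral_wave_mean4_nonneg: "integral {0..1} (wave_mean4 \<omega> a c) \<ge> 0"
  by (intro integral_nonneg integrable_continuous_interval continuous_on_wave_mean4 wave_mean4_nonneg)

lemma wave_norm4_power: "wave_norm4 \<omega> a c ^ 4 = integral {0..1} (wave_mean4 \<omega> a c)"
proof -
  have "wave_norm4 \<omega> a c ^ 4 = wave_norm4 \<omega> a c powr 4"
    by (cases "integral {0..1} (wave_mean4 \<omega> a c) = 0") (simp_all add: wave_norm4_def powr_numeral)
  also have "\<dots> = integral {0..1} (wave_mean4 \<omega> a c)"
    using integral_wave_mean4_nonneg[of \<omega> a c] by (simp add: wave_norm4_def powr_powr)
  finally show ?thesis .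
qed

lemma mixed_norm_wave:
  assumes "nonresonant \<omega>" "c \<in> finite_support"
  shows "mixed_norm 4 (wave \<omega> a c) = ennreal (wave_norm4 \<omega> a c)"
proof -
  have "(\<integral>\<^sup>+t\<in>{0..1}. mean_norm_pow 4 (wave \<omega> a c t) \<partial>lborel) = ennreal (integral {0..1} (wave_mean4 \<omega> a c))"
    unfolding mean_norm_pow_wave[OF assms]
    by (rule set_nn_integral_continuous) (auto intro: continuous_on_wave_mean4 wave_mean4_nonneg)
  then show ?thesis
    by (simp add: mixed_norm_def ennreal_root_def wave_norm4_def integral_wave_mean4_nonneg)
qed

text \<open>Convexity of the fourth power at the points \<open>p / x\<close> and
  \<open>q / y\<close> with weights \<open>x / (x + y)\<close> and \<open>y / (x + y)\<close>. The
  right side is linear in the fourth powers, so the inequality survives averages, limits and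
  integrals, and yields Minkowski's inequality for the iterated norm.\<close>

lemma add_power4_le_weighted:
  fixes p q x y :: real
  assumes "x > 0" "y > 0"
  shows "(p + q) ^ 4 \<le> (x + y) ^ 3 * (p ^ 4 / x ^ 3 + q ^ 4 / y ^ 3)"
proof -
  have "((1 - y / (x + y)) *\<^sub>R (p / x) + (y / (x + y)) *\<^sub>R (q / y)) ^ 4
      \<le> (1 - y / (x + y)) * (p / x) ^ 4 + y / (x + y) * (q / y) ^ 4"
    using assms by (intro convex_onD[OF convex_power_even]) auto
  moreover have "1 - y / (x + y) = x / (x + y)" using assms by (simp add: field_simps)
  ultimately have "((p + q) / (x + y)) ^ 4 \<le> x / (x + y) * (p / x) ^ 4 + y / (x + y) * (q / y) ^ 4"
    using assms by (simp add: add_divide_distrib)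
  then have "(x + y) ^ 4 * ((p + q) / (x + y)) ^ 4 \<le> (x + y) ^ 4 * (x / (x + y) * (p / x) ^ 4 + y / (x + y) * (q / y) ^ 4)"
    using assms by (intro mult_left_mono) auto
  moreover have "(x + y) ^ 4 * ((p + q) / (x + y)) ^ 4 = (p + q) ^ 4"
    using assms by (simp add: power_divide)
  moreover have "(x + y) ^ 4 * (x / (x + y) * (p / x) ^ 4 + y / (x + y) * (q / y) ^ 4)
      = (x + y) ^ 3 * (p ^ 4 / x ^ 3 + q ^ 4 / y ^ 3)"
  proof -
    have *: "z * (r / z) ^ 4 = r ^ 4 / z ^ 3" if "z > 0" for r z :: real
      using that by (simp add: power_divide field_simps eval_nat_numeral)
    have "w ^ 4 * (x / w * P + y / w * Q) = w ^ 3 * (x * P + y * Q)" if "w > 0" for w P Q :: real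
      using that by (simp add: field_simps eval_nat_numeral)
    from this[of "x + y" "(p / x) ^ 4" "(q / y) ^ 4"] show ?thesis
      using assms by (simp only: * add_pos_pos)
  qed
  ultimately show ?thesis by simp
qed

text \<open>Minkowski's inequality: the weighted bound is averaged in space, passed to the limit and
  integrated in time. With \<open>x\<close> and \<open>y\<close> slightly above the two norms, the
  right side is at most \<open>(x + y) ^ 4\<close>.\<close>

lemma wave_norm4_triangle:
  assumes \<omega>: "nonresonant \<omega>" and c: "c \<in> finite_support" and d: "d \<in> finite_support"
  shows "wave_norm4 \<omega> a (\<lambda>k. c k + d k) \<le> wave_norm4 \<omega> a c + wave_norm4 \<omega> a d"
proof (rule field_le_epsilon)
  fix e :: real assume "e > 0"
  \<comment> \<open>The \<open>e / 2\<close> keeps both weights positive even when a norm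
    vanishes.\<close>
  define x y where "x = wave_norm4 \<omega> a c + e / 2" and "y = wave_norm4 \<omega> a d + e / 2"
  have n0: "wave_norm4 \<omega> a b \<ge> 0" for b by (simp add: wave_norm4_def)
  have "x > 0" "y > 0" using n0 \<open>e > 0\<close> by (auto simp: x_def y_def add_nonneg_pos)
  have mean: "wave_mean4 \<omega> a (\<lambda>k. c k + d k) t
      \<le> (x + y) ^ 3 * (wave_mean4 \<omega> a c t / x ^ 3 + wave_mean4 \<omega> a d t / y ^ 3)" for t
  proof (rule tendsto_le[OF trivial_limit_at_top_linorder])
    let ?M = "\<lambda>b L. 1 / (2 * L) * integral {-L..L} (\<lambda>x. norm (wave \<omega> a b t x) ^ 4)"
    show "((?M (\<lambda>k. c k + d k)) \<longlongrightarrow> wave_mean4 \<omega> a (\<lambda>k. c k + d k) t) at_top"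
      using finite_support_add[OF c d] by (intro wave_mean4_tendsto[OF \<omega>]) auto
    show "((\<lambda>L. (x + y) ^ 3 * (?M c L / x ^ 3 + ?M d L / y ^ 3))
        \<longlongrightarrow> (x + y) ^ 3 * (wave_mean4 \<omega> a c t / x ^ 3 + wave_mean4 \<omega> a d t / y ^ 3)) at_top"
      using c d \<open>x > 0\<close> \<open>y > 0\<close> by (intro tendsto_intros wave_mean4_tendsto[OF \<omega>]) auto
    show "\<forall>\<^sub>F L in at_top. ?M (\<lambda>k. c k + d k) L \<le> (x + y) ^ 3 * (?M c L / x ^ 3 + ?M d L / y ^ 3)"
      using eventually_gt_at_top[of 0]
    proof eventually_elim
      case (elim L)
      define w where "w = (\<lambda>b x. norm (wave \<omega> a b t x) ^ 4)"
      have int: "(w b) integrable_on {-L..L}" for b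
        unfolding w_def by (intro integrable_continuous_interval continuous_intros continuous_on_wave)
      have "((\<lambda>u. (x + y) ^ 3 * (w c u / x ^ 3 + w d u / y ^ 3)) has_integral
          (x + y) ^ 3 * (integral {-L..L} (w c) / x ^ 3 + integral {-L..L} (w d) / y ^ 3)) {-L..L}"
        by (intro has_integral_mult_right has_integral_add has_integral_divide integrable_integral int)
      moreover have "w (\<lambda>k. c k + d k) u \<le> (x + y) ^ 3 * (w c u / x ^ 3 + w d u / y ^ 3)" for u
      proof -
        have "w (\<lambda>k. c k + d k) u \<le> (norm (wave \<omega> a c t u) + norm (wave \<omega> a d t u)) ^ 4"
          unfolding w_def wave_add[OF c d] by (intro power_mono norm_triangle_ineq) simp
        also have "\<dots> \<le> (x + y) ^ 3 * (w c u / x ^ 3 + w d u / y ^ 3)"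
          unfolding w_def by (rule add_power4_le_weighted[OF \<open>x > 0\<close> \<open>y > 0\<close>])
        finally show ?thesis .
      qed
      ultimately have "integral {-L..L} (w (\<lambda>k. c k + d k))
          \<le> (x + y) ^ 3 * (integral {-L..L} (w c) / x ^ 3 + integral {-L..L} (w d) / y ^ 3)"
        by (intro has_integral_le[OF integrable_integral[OF int]]) auto
      then have "1 / (2 * L) * integral {-L..L} (w (\<lambda>k. c k + d k))
          \<le> 1 / (2 * L) * ((x + y) ^ 3 * (integral {-L..L} (w c) / x ^ 3 + integral {-L..L} (w d) / y ^ 3))"
        using elim by (intro mult_left_mono) auto
      also have "\<dots> = (x + y) ^ 3 * (1 / (2 * L) * integral {-L..L} (w c) / x ^ 3 + 1 / (2 * L) * integral {-L..L} (w d) / y ^ 3)"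
        by (simp add: algebra_simps add_divide_distrib)
      finally show ?case by (simp add: w_def)
    qed
  qed
  have int: "(wave_mean4 \<omega> a b) integrable_on {0..1}" for b
    by (intro integrable_continuous_interval continuous_on_wave_mean4)
  have "((\<lambda>t. (x + y) ^ 3 * (wave_mean4 \<omega> a c t / x ^ 3 + wave_mean4 \<omega> a d t / y ^ 3)) has_integral
      (x + y) ^ 3 * (wave_norm4 \<omega> a c ^ 4 / x ^ 3 + wave_norm4 \<omega> a d ^ 4 / y ^ 3)) {0..1}"
    unfolding wave_norm4_power
    by (intro has_integral_mult_right has_integral_add has_integral_divide integrable_integral int)
  then have "wave_norm4 \<omega> a (\<lambda>k. c k + d k) ^ 4
      \<le> (x + y) ^ 3 * (wave_norm4 \<omega> a c ^ 4 / x ^ 3 + wave_norm4 \<omega> a d ^ 4 / y ^ 3)"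
    unfolding wave_norm4_power[of \<omega> a "\<lambda>k. c k + d k"]
    by (intro has_integral_le[OF integrable_integral[OF int]]) (auto intro: mean)
  also have "\<dots> \<le> (x + y) ^ 3 * (x + y)"
  proof -
    have "z ^ 4 / u ^ 3 \<le> u" if "0 \<le> z" "z \<le> u" "u > 0" for z u :: real
    proof -
      have "z ^ 4 \<le> u ^ 4" using that by (intro power_mono)
      then show ?thesis using that by (simp add: field_simps eval_nat_numeral)
    qed
    then show ?thesis
      using n0 \<open>e > 0\<close> \<open>x > 0\<close> \<open>y > 0\<close> by (intro mult_left_mono add_mono) (auto simp: x_def y_def)
  qed
  also have "\<dots> = (x + y) ^ 4" by (simp add: eval_nat_numeral)
  finally have "wave_norm4 \<omega> a (\<lambda>k. c k + d k) ^ 4 \<le> (x + y) ^ 4" .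
  moreover have "x + y \<ge> 0" using \<open>x > 0\<close> \<open>y > 0\<close> by simp
  ultimately have "wave_norm4 \<omega> a (\<lambda>k. c k + d k) \<le> x + y"
    using power_mono_iff[OF n0, of "x + y" 4 "\<lambda>k. c k + d k"] by simp
  then show "wave_norm4 \<omega> a (\<lambda>k. c k + d k) \<le> wave_norm4 \<omega> a c + wave_norm4 \<omega> a d + e"
    by (simp add: x_def y_def)
qed

text \<open>Both families are placed on a common support, where Minkowski's inequality for
  \<open>L2_set\<close> applies.\<close>

lemma weighted_l2_triangle:
  assumes "c \<in> finite_support" "d \<in> finite_support"
  shows "weighted_l2 s (\<lambda>k. c k + d k) \<le> weighted_l2 s c + weighted_l2 s d"
proof -
  define S where "S = {k. c k \<noteq> 0} \<union> {k. d k \<noteq> 0}"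
  define w where "w = (\<lambda>k::int^'a. (1 + (norm (rvec k))\<^sup>2) powr (s / 2))"
  have superset: "weighted_l2 s b = L2_set (\<lambda>k. w k * norm (b k)) S" if "{k. b k \<noteq> 0} \<subseteq> S" for b
    unfolding weighted_l2_def L2_set_def w_def
    using assms that by (intro arg_cong[of _ _ sqrt] sum.mono_neutral_left) (auto simp: S_def)
  have "weighted_l2 s (\<lambda>k. c k + d k) = L2_set (\<lambda>k. w k * norm (c k + d k)) S"
    by (rule superset) (auto simp: S_def)
  also have "\<dots> \<le> L2_set (\<lambda>k. w k * norm (c k) + w k * norm (d k)) S"
    by (intro L2_set_mono) (auto simp: w_def distrib_left[symmetric] intro!: mult_left_mono norm_triangle_ineq)
  also have "\<dots> \<le> L2_set (\<lambda>k. w k * norm (c k)) S + L2_set (\<lambda>k. w k * norm (d k)) S"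
    by (rule L2_set_triangle_ineq)
  finally show ?thesis by (subst (1 2) superset) (auto simp: S_def)
qed

text \<open>Serves both spaces at once: the polynomials are the image of the finitely supported
  coefficients under \<open>trig_sum\<close>, their evolutions the image under \<open>wave\<close>.
  An even, subadditive functional on coefficients that computes \<open>N\<close> transfers its
  properties.\<close>

lemma difference_norm_image:
  fixes \<phi> :: "('k \<Rightarrow> complex) \<Rightarrow> 'v::minus" and R :: "('k \<Rightarrow> complex) \<Rightarrow> real"
  assumes diff: "\<And>c d. c \<in> finite_support \<Longrightarrow> d \<in> finite_support \<Longrightarrow> \<phi> (c - d) = \<phi> c - \<phi> d"
    and N: "\<And>c. c \<in> finite_support \<Longrightarrow> N (\<phi> c) = ennreal (R c)"
    and nonneg: "\<And>c. R c \<ge> 0" and zero: "R (\<lambda>_. 0) = 0" and minus: "\<And>c. R (\<lambda>k. - c k) = R c"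
    and triangle: "\<And>c d. c \<in> finite_support \<Longrightarrow> d \<in> finite_support \<Longrightarrow> R (\<lambda>k. c k + d k) \<le> R c + R d"
  shows "difference_norm (\<phi> ` finite_support) N"
proof -
  have Nd: "N (\<phi> c - \<phi> d) = ennreal (R (c - d))" if "c \<in> finite_support" "d \<in> finite_support" for c d
    using N[OF finite_support_diff[OF that]] diff[OF that] by simp
  have add: "R (\<lambda>k. c k + d k) \<le> R c + R d" if "c \<in> finite_support" "d \<in> finite_support" for c d
    by (rule triangle[OF that])
  have 1: "N (\<phi> c) < \<infinity> \<and> N (\<phi> c - \<phi> c) = 0" if "c \<in> finite_support" for c
  proof -
    have "c - c = (\<lambda>_. 0)" by (simp add: fun_eq_iff)
    then show ?thesis using N[OF that] Nd[OF that that] zero by simp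
  qed
  have 2: "\<phi> c - \<phi> d \<in> \<phi> ` finite_support \<and> N (\<phi> c - \<phi> d) = N (\<phi> d - \<phi> c) \<and> N (\<phi> c) \<le> N (\<phi> d) + N (\<phi> c - \<phi> d)"
    if cd: "c \<in> finite_support" "d \<in> finite_support" for c d
  proof (intro conjI)
    show "\<phi> c - \<phi> d \<in> \<phi> ` finite_support"
      unfolding diff[OF cd, symmetric] by (intro imageI finite_support_diff cd)
    have "d - c = (\<lambda>k. - (c - d) k)" by (simp add: fun_eq_iff)
    then show "N (\<phi> c - \<phi> d) = N (\<phi> d - \<phi> c)" by (simp only: Nd cd minus)
    have "c = (\<lambda>k. d k + (c - d) k)" by (simp add: fun_eq_iff)
    then have "R c \<le> R d + R (c - d)" using add[OF cd(2) finite_support_diff[OF cd]] by metis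
    then show "N (\<phi> c) \<le> N (\<phi> d) + N (\<phi> c - \<phi> d)"
      by (simp only: Nd N cd) (simp add: nonneg flip: ennreal_plus)
  qed
  have 3: "N (\<phi> c - \<phi> b) \<le> N (\<phi> c - \<phi> d) + N (\<phi> d - \<phi> b)"
    if "c \<in> finite_support" "d \<in> finite_support" "b \<in> finite_support" for b c d
  proof -
    have "c - b = (\<lambda>k. (c - d) k + (d - b) k)" by (simp add: fun_eq_iff)
    then have "R (c - b) \<le> R (c - d) + R (d - b)"
      using add[OF finite_support_diff[OF that(1,2)] finite_support_diff[OF that(2,3)]] by metis
    then show ?thesis
      by (simp only: Nd that) (simp add: nonneg flip: ennreal_plus)
  qed
  show ?thesis
    unfolding difference_norm_def ball_simps using 1 2 3 by blast
qed

theorem theorem6: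
  fixes \<omega> :: "real ^ 'n::finite" and a s :: real
  assumes "CARD('n) \<ge> 2"
    and "nonresonant \<omega>"
    and "a \<in> {0<..<1} \<union> {1<..}"
    and "s = (real CARD('n) - 1) / 4 + sigma a"
  shows "\<exists>K::real.
    (\<forall>f\<in>trig_polys \<omega>. mixed_norm 4 (propagator \<omega> a f) \<le> ennreal K * sobolev_norm \<omega> s f) \<and>
    (\<forall>\<xi>\<in>sobolev_space \<omega> s.
       completion_map (propagator \<omega> a) (propagator \<omega> a ` trig_polys \<omega>) (mixed_norm 4) \<xi>
         \<in> completion (propagator \<omega> a ` trig_polys \<omega>) (mixed_norm 4) \<and>
       completion_norm (mixed_norm 4)
         (completion_map (propagator \<omega> a) (propagator \<omega> a ` trig_polys \<omega>) (mixed_norm 4) \<xi>)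
         \<le> ennreal K * completion_norm (sobolev_norm \<omega> s) \<xi>)"
proof -
  note \<omega> = \<open>nonresonant \<omega>\<close>
  have "a > 0" "a \<noteq> 1" using assms(3) by auto
  from integral_wave_mean4_le[OF assms(1) \<omega> this assms(4)] obtain K where "K \<ge> 0" and
    K: "\<And>c. finite {k. c k \<noteq> 0} \<Longrightarrow> integral {0..1} (wave_mean4 \<omega> a c) \<le> K * weighted_l2 s c ^ 4"
    by blast
  have polys: "trig_polys \<omega> = trig_sum \<omega> ` finite_support" by (auto simp: trig_polys_def)
  \<comment> \<open>The target of the extension is the completion of the evolved polynomials, which
    are the waves with finitely supported coefficients.\<close>
  have range: "propagator \<omega> a ` trig_polys \<omega> = wave \<omega> a ` finite_support"
    unfolding polys image_image using propagator_trig_sum[OF \<omega>] by (intro image_cong) auto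
  have bound: "mixed_norm 4 (propagator \<omega> a f) \<le> ennreal (K powr (1 / 4)) * sobolev_norm \<omega> s f"
    if f_poly: "f \<in> trig_polys \<omega>" for f
  proof -
    obtain c where c: "c \<in> finite_support" and f: "f = trig_sum \<omega> c"
      using f_poly unfolding polys by blast
    have w0: "weighted_l2 s c \<ge> 0" by (simp add: weighted_l2_def L2_set_nonneg)
    have "wave_norm4 \<omega> a c \<le> (K * weighted_l2 s c ^ 4) powr (1 / 4)"
      unfolding wave_norm4_def using K c integral_wave_mean4_nonneg by (intro powr_mono2) auto
    also have "\<dots> = K powr (1 / 4) * weighted_l2 s c"
    proof -
      have "(weighted_l2 s c ^ 4) powr (1 / 4) = weighted_l2 s c"
        using w0 by (cases "weighted_l2 s c = 0") (simp_all add: powr_powr flip: powr_numeral)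
      then show ?thesis using \<open>K \<ge> 0\<close> w0 by (simp add: powr_mult)
    qed
    finally show ?thesis
      unfolding f propagator_trig_sum[OF \<omega> c] mixed_norm_wave[OF \<omega> c] sobolev_norm_trig_sum[OF \<omega> c]
      using w0 by (simp flip: ennreal_mult)
  qed
  have V: "difference_norm (trig_polys \<omega>) (sobolev_norm \<omega> s)"
    unfolding polys
  proof (rule difference_norm_image[where R = "weighted_l2 s"])
    show "weighted_l2 s c \<ge> 0" "weighted_l2 s (\<lambda>_. 0) = 0" "weighted_l2 s (\<lambda>k. - c k) = weighted_l2 s c"
      for c :: "int ^ 'n \<Rightarrow> complex"
      by (simp_all add: weighted_l2_def L2_set_nonneg)
  qed (intro trig_sum_diff sobolev_norm_trig_sum \<omega> weighted_l2_triangle; assumption)+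
  have W: "difference_norm (propagator \<omega> a ` trig_polys \<omega>) (mixed_norm 4)"
    unfolding range
  proof (rule difference_norm_image[where R = "wave_norm4 \<omega> a"])
    show "wave_norm4 \<omega> a c \<ge> 0" "wave_norm4 \<omega> a (\<lambda>_. 0) = 0" "wave_norm4 \<omega> a (\<lambda>k. - c k) = wave_norm4 \<omega> a c"
      for c :: "int ^ 'n \<Rightarrow> complex"
      by (simp_all add: wave_norm4_def wave_mean4_def[abs_def])
  qed (intro wave_diff mixed_norm_wave \<omega> wave_norm4_triangle; assumption)+
  have T: "propagator \<omega> a (f - g) = propagator \<omega> a f - propagator \<omega> a g"
    if fg: "f \<in> trig_polys \<omega>" "g \<in> trig_polys \<omega>" for f g
  proof -
    obtain c d where cd: "c \<in> finite_support" "d \<in> finite_support" and "f = trig_sum \<omega> c" "g = trig_sum \<omega> d"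
      using fg unfolding polys by blast
    then show ?thesis
      by (simp only: trig_sum_diff[OF cd, symmetric] propagator_trig_sum[OF \<omega>] finite_support_diff wave_diff)
  qed
  \<comment> \<open>One constant, the fourth root of \<open>K\<close>, serves both claims, since the
    extension inherits the bound for polynomials.\<close>
  show ?thesis
    using bound completion_extension[where T = "propagator \<omega> a" and V = "trig_polys \<omega>", OF V W T bound]
    by (intro exI[of _ "K powr (1 / 4)"] conjI ballI) blast+
qed

end
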